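(* Let $\alpha,\beta\in\mathbb{C}\setminus\mathbb{Z}^-$ with $\operatorname{Re}(\alpha+\beta)>-1$, let $1\le p\le\infty$ with conjugate exponent $q$ ($\frac1p+\frac1q=1$), let $f\in L^p(\mathbb{T})$ and let $w=K_{\alpha,\beta}[f]$, an $(\alpha,\beta)$-harmonic function on $\mathbb{D}$. Suppose $w$ has the expansion $$w(z)=\sum_{m=0}^\infty c_m\,F(-\alpha,m-\beta;m+1;|z|^2)\,z^m+\sum_{m=1}^\infty c_{-m}\,F(-\beta,m-\alpha;m+1;|z|^2)\,\bar z^{\,m}\qquad(z\in\mathbb{D})$$ with complex coefficients $\{c_m\}_{m\in\mathbb{Z}}$ satisfying $\limsup_{|m|\to\infty}|c_m|^{1/|m|}\le1$. Then for every $k=1,2,\dots$: (i) $$|c_k|\le|c_{\alpha,\beta}|\frac{|(\alpha+1)_k|}{k!}\|f\|_{L^p(\mathbb{T})},\qquad|c_{-k}|\le|c_{\alpha,\beta}|\frac{|(\beta+1)_k|}{k!}\|f\|_{L^p(\mathbb{T})}.$$ (ii) $$\frac{k!}{|(\alpha+1)_k|}|c_k|+\frac{k!}{|(\beta+1)_k|}|c_{-k}|\le2|c_{\alpha,\beta}|\,C_q\,\|f\|_{L^p(\mathbb{T})},$$ where $C_q=\left(\frac1{2\pi}\int_0^{2\pi}|\cos(kt)|^q\,dt\right)^{1/q}$ (with the usual essential supremum interpretation, $C_\infty=1$, when $q=\infty$). In particular, when $p=\infty$ (so that $C_q=C_1=\frac2\pi$) and $\alpha=\beta=0$, one has $|c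_k|+|c_{-k}|\le\frac4\pi\|f\|_\infty$.
   Context: $\mathbb{D}=\{z\in\mathbb{C}:|z|<1\}$, $\mathbb{T}=\{z\in\mathbb{C}:|z|=1\}$, and $\mathbb{Z}^-$ is the set of negative integers. Set $$c_{\alpha,\beta}=\frac{\Gamma(\alpha+1)\Gamma(\beta+1)}{\Gamma(\alpha+\beta+1)}$$ (this constant is distinct from the coefficients $c_m$), and $$K_{\alpha,\beta}(z)=c_{\alpha,\beta}\frac{(1-|z|^2)^{\alpha+\beta+1}}{(1-z)^{\alpha+1}(1-\bar z)^{\beta+1}}\quad(z\in\mathbb{D}),$$ with principal branches of the powers, and $$K_{\alpha,\beta}[f](z)=\frac1{2\pi}\int_0^{2\pi}K_{\alpha,\beta}(ze^{-it})f(e^{it})\,dt .$$ A $C^2$ function $w$ on $\mathbb{D}$ is $(\alpha,\beta)$-harmonic if $(1-|z|^2)\partial_z\partial_{\bar z}w+\alpha z\partial_zw+\beta\bar z\partial_{\bar z}w-\alpha\beta w=0$ in $\mathbb{D}$; it is known (Klintberg–Olofsson) that $w$ is $(\alpha,\beta)$-harmonic if and only if it has an expansion of the form in the claim with $\limsup_{|m|\to\infty}|c_m|^{1/|m|}\le1$, and that the sums then converge absolutely in $C^\infty(\mathbb{D})$. $\|f\|_{L^p(\mathbb{T})}=\left(\frac1{2\pi}\int_0^{2\pi}|f(e^{i\theta})|^p\,d\theta\right)^{1/p}$ for $p<\infty$, and the essential supremum of $|f|$ for $p=\infty$. $F(a,b;c;x)=\sum_{n\ge0}\frac{(a)_n(b)_n}{(c)_n}\frac{x^n}{n!}$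 is the Gauss hypergeometric function, with $(a)_0=1$, $(a)_n=a(a+1)\cdots(a+n-1)$. *)

theory Defs
  imports "HOL-Analysis.Analysis" "HOL-Probability.Essential_Supremum"
begin

definition hypergeom_F :: "complex \<Rightarrow> complex \<Rightarrow> complex \<Rightarrow> complex \<Rightarrow> complex" where
  "hypergeom_F a b c x =
     (\<Sum>n. pochhammer a n * pochhammer b n / pochhammer c n * x ^ n / fact n)"

definition c_const :: "complex \<Rightarrow> complex \<Rightarrow> complex" where
  "c_const \<alpha> \<beta> = Gamma (\<alpha> + 1) * Gamma (\<beta> + 1) / Gamma (\<alpha> + \<beta> + 1)"

definition ab_kernel :: "complex \<Rightarrow> complex \<Rightarrow> complex \<Rightarrow> complex" where
  "ab_kernel \<alpha> \<beta> z =
     c_const \<alpha> \<beta> * (complex_of_real (1 - (cmod z)\<^sup>2) powr (\<alpha> + \<beta> + 1) /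
       ((1 - z) powr (\<alpha> + 1) * (1 - cnj z) powr (\<beta> + 1)))"

definition ab_Poisson :: "complex \<Rightarrow> complex \<Rightarrow> (complex \<Rightarrow> complex) \<Rightarrow> complex \<Rightarrow> complex" where
  "ab_Poisson \<alpha> \<beta> f z =
     1 / (2 * pi) * (LINT t|lebesgue_on {0..2*pi}. ab_kernel \<alpha> \<beta> (z * cis (- t)) * f (cis t))"

(* Functions on the unit circle are handled through their pullback t \<mapsto> g t along
   t \<mapsto> cis t, restricted to {0..2*pi}. The exponent ranges over [1, \<infinity>] in ennreal. *)

definition in_Lp :: "ennreal \<Rightarrow> (real \<Rightarrow> 'a::real_normed_vector) \<Rightarrow> bool" where
  "in_Lp p g \<longleftrightarrow>
     g \<in> borel_measurable (lebesgue_on {0..2*pi}) \<and>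
     (if p = \<infinity> then esssup (lebesgue_on {0..2*pi}) (\<lambda>t. ennreal (norm (g t))) < \<infinity>
      else integrable (lebesgue_on {0..2*pi}) (\<lambda>t. norm (g t) powr enn2real p))"

(* Real-valued, hence meaningful only for g satisfying in_Lp p g. *)
definition Lp_norm :: "ennreal \<Rightarrow> (real \<Rightarrow> 'a::real_normed_vector) \<Rightarrow> real" where
  "Lp_norm p g =
     (if p = \<infinity> then enn2real (esssup (lebesgue_on {0..2*pi}) (\<lambda>t. ennreal (norm (g t))))
      else (1 / (2*pi) * (LINT t|lebesgue_on {0..2*pi}. norm (g t) powr enn2real p))
             powr (1 / enn2real p))"

definition cos_const :: "ennreal \<Rightarrow> nat \<Rightarrow> real" where
  "cos_const q k = Lp_norm q (\<lambda>t. cos (real k * t))"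

(* Under root_limsup_le_1 below, all series converge absolutely for |z| < 1,
   so suminf is never used at a divergent series there. *)
definition ab_expansion :: "complex \<Rightarrow> complex \<Rightarrow> (int \<Rightarrow> complex) \<Rightarrow> complex \<Rightarrow> complex" where
  "ab_expansion \<alpha> \<beta> c z =
     (\<Sum>m::nat. c (int m) *
        hypergeom_F (- \<alpha>) (of_nat m - \<beta>) (of_nat m + 1) (of_real ((cmod z)\<^sup>2)) * z ^ m) +
     (\<Sum>j::nat. let m = Suc j in c (- int m) *
        hypergeom_F (- \<beta>) (of_nat m - \<alpha>) (of_nat m + 1) (of_real ((cmod z)\<^sup>2)) * cnj z ^ m)"

definition root_limsup_le_1 :: "(int \<Rightarrow> complex) \<Rightarrow> bool" where
  "root_limsup_le_1 c \<longleftrightarrow>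
     Limsup (filtercomap (\<lambda>m::int. \<bar>m\<bar>) at_top)
       (\<lambda>m. ereal (root (nat \<bar>m\<bar>) (cmod (c m)))) \<le> 1"

end

theory Submission
  imports Defs
begin

text \<open>
  Both \<open>K\<^sub>\<alpha>\<^sub>,\<^sub>\<beta>[f]\<close> and the hypergeometric expansion agree with a polynomial in
  \<open>z\<close> and its conjugate up to an error \<open>O(r^(k+1))\<close> on the circle of radius \<open>r\<close>. Extracting the
  coefficient of \<open>cis (k\<theta>)\<close> from the two polynomials, dividing by \<open>r^k\<close> and letting \<open>r\<close> tend to
  \<open>0\<close> expresses \<open>c\<^sub>k\<close> as \<open>c\<^sub>\<alpha>\<^sub>,\<^sub>\<beta> (\<alpha>+1)\<^sub>k / k!\<close> times the \<open>k\<close>-th Fourier coefficient of \<open>f\<close>; Euler's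
  transformation of the hypergeometric function is not needed, because every hypergeometric
  factor tends to \<open>1\<close>. Hoelder's inequality gives the first bound. For the second, multiply the
  Fourier coefficients of index \<open>k\<close> and \<open>-k\<close> by unimodular constants making them nonnegative:
  their sum is the mean of \<open>f\<close> against a function of modulus \<open>2 \<bar>cos (kt + \<phi>)\<bar>\<close>, whose \<open>L\<^sup>q\<close> norm
  does not depend on the phase \<open>\<phi>\<close>.
\<close>

subsection \<open>Behaviour at the origin\<close>

text \<open>Factor by factor: since R is at least 1, |a + j| is at most |a| + j, hence at most R (b
  + j). The case b = m + 1 yields bounds on hypergeometric coefficients that do not deteriorate as m
  grows.\<close>

lemma norm_pochhammer_le:
  fixes a :: complex and b R :: real
  assumes "1 \<le> R" and "0 \<le> b" and "cmod a \<le> R * b"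
  shows "cmod (pochhammer a n) \<le> R ^ n * pochhammer b n"
proof (induction n)
  case (Suc n)
  have "cmod (a + of_nat n) \<le> cmod a + real n"
    by (metis norm_of_nat norm_triangle_ineq)
  also have "\<dots> \<le> R * (b + real n)"
    using assms mult_right_mono[of 1 R "real n"] by (simp add: distrib_left)
  finally have "cmod (a + of_nat n) \<le> R * (b + real n)" .
  then have "cmod (pochhammer a n) * cmod (a + of_nat n)
      \<le> (R ^ n * pochhammer b n) * (R * (b + real n))"
    using Suc assms by (intro mult_mono) (auto intro!: mult_nonneg_nonneg pochhammer_nonneg
      simp: pochhammer_prod prod_nonneg)
  then show ?case
    by (simp add: pochhammer_Suc norm_mult mult_ac)
qed auto

lemma norm_pochhammer_div_fact_le:
  "cmod (pochhammer a n / fact n) \<le> (1 + cmod a) ^ n"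
proof -
  have "cmod (pochhammer a n) \<le> (1 + cmod a) ^ n * pochhammer 1 n"
    by (rule norm_pochhammer_le) auto
  then show ?thesis
    by (simp add: norm_divide pochhammer_fact[symmetric] pos_divide_le_eq)
qed

text \<open>The series is dominated by B x^n with x = R |z| at most 1/2, so the tail after index k
  is at most B x^(k+1) / (1 - x). The factor 2 bounds 1 / (1 - x). That B is nonnegative comes from
  the hypothesis at n = 0.\<close>

lemma geometric_majorant:
  fixes a :: "nat \<Rightarrow> complex"
  assumes a: "\<And>n. cmod (a n) \<le> B * R ^ n" and R: "0 \<le> R" "R * cmod z \<le> 1 / 2"
  shows summable_geometric_majorant: "summable (\<lambda>n. a n * z ^ n)"
    and power_series_remainder:
      "cmod ((\<Sum>n. a n * z ^ n) - (\<Sum>n\<le>k. a n * z ^ n)) \<le> 2 * B * (R * cmod z) ^ Suc k"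
proof -
  define x where "x = R * cmod z"
  have x: "0 \<le> x" "x \<le> 1 / 2" using R by (auto simp: x_def)
  have B: "0 \<le> B" using a[of 0] norm_ge_zero[of "a 0"] by (simp del: norm_ge_zero)
  have le: "cmod (a n * z ^ n) \<le> B * x ^ n" for n
    using mult_right_mono[OF a[of n], of "cmod z ^ n"]
    by (simp add: x_def norm_mult norm_power power_mult_distrib mult_ac)
  have sg: "(\<lambda>n. B * x ^ n) sums (B * (1 / (1 - x)))"
    using x by (intro sums_mult geometric_sums) auto
  show sm: "summable (\<lambda>n. a n * z ^ n)"
    by (rule summable_comparison_test'[OF sums_summable[OF sg], of 0]) (use le in auto)
  have "(\<Sum>n. a n * z ^ n) - (\<Sum>n\<le>k. a n * z ^ n) = (\<Sum>n. a (n + Suc k) * z ^ (n + Suc k))"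
    using suminf_minus_initial_segment[OF sm, of "Suc k"] by (simp add: lessThan_Suc_atMost)
  also have "cmod \<dots> \<le> (\<Sum>n. x ^ Suc k * (B * x ^ n))"
  proof (rule norm_suminf_le)
    show "cmod (a (n + Suc k) * z ^ (n + Suc k)) \<le> x ^ Suc k * (B * x ^ n)" for n
      using le[of "n + Suc k"] by (simp add: power_add mult_ac)
  qed (use sg in \<open>auto intro!: summable_mult dest: sums_summable\<close>)
  also have "\<dots> = x ^ Suc k * (B * (1 / (1 - x)))"
    using sums_unique[OF sums_mult[OF sg, of "x ^ Suc k"]] by simp
  also have "\<dots> \<le> x ^ Suc k * (B * 2)"
    using x B by (intro mult_left_mono) (auto simp: field_simps)
  finally show "cmod ((\<Sum>n. a n * z ^ n) - (\<Sum>n\<le>k. a n * z ^ n)) \<le> 2 * B * (R * cmod z) ^ Suc k"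
    by (simp add: x_def mult_ac)
qed

section \<open>Hypergeometric factors and truncation of the expansion\<close>

text \<open>The remainder estimate after the constant term. What matters is uniformity in m: because
  |m - b| is at most (1 + |b|) (m + 1), the denominator \<open>pochhammer (of_nat m + 1) n\<close>
  absorbs the growth of the numerator, and a single radius serves all terms of the
  expansion.\<close>

lemma hypergeom_F_near_one:
  fixes m :: nat
  assumes x: "((1 + cmod a) * (1 + cmod b)) * cmod x \<le> 1 / 2"
  shows "cmod (hypergeom_F (- a) (of_nat m - b) (of_nat m + 1) x - 1)
     \<le> 2 * ((1 + cmod a) * (1 + cmod b)) * cmod x"
proof -
  define h where "h n = pochhammer (- a) n * pochhammer (of_nat m - b) n
     / pochhammer (of_nat m + 1) n / fact n" for n
  have "cmod (of_nat m - b) \<le> real m + cmod b"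
    by (metis norm_of_nat norm_triangle_ineq4)
  also have "\<dots> \<le> (1 + cmod b) * (real m + 1)"
    by (simp add: algebra_simps)
  finally have mb: "cmod (of_nat m - b) \<le> (1 + cmod b) * (real m + 1)" .
  have h: "cmod (h n) \<le> 1 * ((1 + cmod a) * (1 + cmod b)) ^ n" for n
  proof -
    have p: "pochhammer (real m + 1) n > 0" by (simp add: pochhammer_pos)
    have "pochhammer (of_nat m + 1) n = complex_of_real (pochhammer (real m + 1) n)"
      by (simp flip: pochhammer_of_real)
    then have "cmod (h n) = cmod (pochhammer (- a) n / fact n)
        * (cmod (pochhammer (of_nat m - b) n) / pochhammer (real m + 1) n)"
      using p by (simp add: h_def norm_mult norm_divide)
    also have "\<dots> \<le> (1 + cmod (- a)) ^ n * (1 + cmod b) ^ n"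
    proof (intro mult_mono norm_pochhammer_div_fact_le)
      show "cmod (pochhammer (of_nat m - b) n) / pochhammer (real m + 1) n \<le> (1 + cmod b) ^ n"
        using p norm_pochhammer_le[OF _ _ mb, of n] by (simp add: pos_divide_le_eq)
    qed (use p in auto)
    finally show ?thesis by (simp add: power_mult_distrib)
  qed
  have "cmod ((\<Sum>n. h n * x ^ n) - (\<Sum>n\<le>0. h n * x ^ n))
      \<le> 2 * 1 * (((1 + cmod a) * (1 + cmod b)) * cmod x) ^ Suc 0"
    by (rule power_series_remainder[OF h]) (use x in auto)
  moreover have "hypergeom_F (- a) (of_nat m - b) (of_nat m + 1) x = (\<Sum>n. h n * x ^ n)"
    by (simp add: hypergeom_F_def h_def mult_ac)
  ultimately show ?thesis by (simp add: h_def)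
qed

text \<open>Any base above 1 is eventually admissible; 2 is taken for definiteness. The finitely
  many remaining indices are absorbed into B by adding up their moduli.\<close>

lemma root_limsup_le_1_imp_bound:
  assumes "root_limsup_le_1 c"
  obtains B where "0 \<le> B" and "\<And>m. cmod (c m) \<le> B * 2 ^ nat \<bar>m\<bar>"
proof -
  have "eventually (\<lambda>m. ereal (root (nat \<bar>m\<bar>) (cmod (c m))) < 2)
      (filtercomap (\<lambda>m::int. \<bar>m\<bar>) at_top)"
  proof (rule Limsup_lessD)
    show "Limsup (filtercomap (\<lambda>m::int. \<bar>m\<bar>) at_top)
        (\<lambda>m. ereal (root (nat \<bar>m\<bar>) (cmod (c m)))) < 2"
      by (rule order.strict_trans1[OF assms[unfolded root_limsup_le_1_def]]) simp
  qed
  then obtain N where N: "\<And>m. N \<le> \<bar>m\<bar> \<Longrightarrow> root (nat \<bar>m\<bar>) (cmod (c m)) < 2"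
    unfolding eventually_filtercomap_at_top_linorder by auto
  \<comment> \<open>The maximum with 1 keeps m = 0 out of the tail case: \<open>root 0\<close> is 0
    by convention and says nothing about c 0.\<close>
  define N' where "N' = max N 1"
  define B where "B = 1 + (\<Sum>m\<in>{-N'..N'}. cmod (c m))"
  have B: "1 \<le> B" by (simp add: B_def sum_nonneg)
  show thesis
  proof (rule that[of B])
    fix m :: int
    show "cmod (c m) \<le> B * 2 ^ nat \<bar>m\<bar>"
    proof (cases "\<bar>m\<bar> \<le> N'")
      case True
      then have "cmod (c m) \<le> (\<Sum>m\<in>{-N'..N'}. cmod (c m))"
        by (intro member_le_sum) auto
      also have "\<dots> \<le> B * 1" by (simp add: B_def)
      also have "\<dots> \<le> B * 2 ^ nat \<bar>m\<bar>" using B by (intro mult_left_mono) auto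
      finally show ?thesis .
    next
      case False
      then have m: "nat \<bar>m\<bar> > 0" "N \<le> \<bar>m\<bar>" by (auto simp: N'_def)
      have "cmod (c m) = root (nat \<bar>m\<bar>) (cmod (c m)) ^ nat \<bar>m\<bar>"
        using m by simp
      also have "\<dots> \<le> 2 ^ nat \<bar>m\<bar>"
        using N[OF m(2)] m by (intro power_mono) auto
      also have "\<dots> \<le> B * 2 ^ nat \<bar>m\<bar>" using B by simp
      finally show ?thesis .
    qed
  qed (use B in auto)
qed

text \<open>The hypergeometric factors depend on |z| only, so for fixed |z| the expansion is a power
  series in z plus one in the conjugate of z, with coefficients bounded by 2 B 2^m. Setting N to 0
  at m = 0 lets both series start at index 0.\<close>

lemma ab_expansion_remainder:
  fixes c :: "int \<Rightarrow> complex" and \<alpha> \<beta> :: complex and k :: nat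
  defines "P \<equiv> \<lambda>m x. c (int m) * hypergeom_F (- \<alpha>) (of_nat m - \<beta>) (of_nat m + 1) (of_real x)"
  defines "N \<equiv> \<lambda>m x. if m = 0 then 0
    else c (- int m) * hypergeom_F (- \<beta>) (of_nat m - \<alpha>) (of_nat m + 1) (of_real x)"
  assumes "root_limsup_le_1 c"
  obtains M \<delta> where "0 < \<delta>" and "\<And>z. cmod z \<le> \<delta> \<Longrightarrow>
    cmod (ab_expansion \<alpha> \<beta> c z
      - ((\<Sum>m\<le>k. P m ((cmod z)\<^sup>2) * z ^ m) + (\<Sum>m\<le>k. N m ((cmod z)\<^sup>2) * cnj z ^ m)))
    \<le> M * cmod z ^ Suc k"
proof -
  obtain B where B: "0 \<le> B" "\<And>m. cmod (c m) \<le> B * 2 ^ nat \<bar>m\<bar>"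
    using root_limsup_le_1_imp_bound[OF assms(3)] by blast
  define K where "K = (1 + cmod \<alpha>) * (1 + cmod \<beta>)"
  have K: "1 \<le> K"
    unfolding K_def using mult_mono[of 1 "1 + cmod \<alpha>" 1 "1 + cmod \<beta>"] by simp
  \<comment> \<open>This radius serves two purposes: it gives 2 |z| at most 1/2 for the majorant
    with ratio 2, and K |z|^2 at most 1/2 so that every hypergeometric factor has modulus at most 2.
    In the constant, the outer 2 counts the two series, and 2 (2 B) comes from the geometric
    tail.\<close>
  show thesis
  proof (rule that[of "1 / (4 * K)" "2 * (2 * (2 * B) * 2 ^ Suc k)"])
    show "0 < 1 / (4 * K)" using K by simp
  next
    fix z assume z: "cmod z \<le> 1 / (4 * K)"
    have Kz: "K * cmod z \<le> 1 / 4" using z K by (simp add: field_simps)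
    have z4: "cmod z \<le> 1 / 4" using Kz K mult_right_mono[of 1 K "cmod z"] by simp
    define x where "x = (cmod z)\<^sup>2"
    have "K * x \<le> 1 / 4 * (1 / 4)"
      unfolding x_def power2_eq_square mult.assoc[symmetric]
      using Kz z4 by (intro mult_mono) auto
    then have Kx: "K * cmod (of_real x) \<le> 1 / 2" by (simp add: norm_of_real x_def del: of_real_power)
    have F: "cmod h \<le> 2" if "cmod (h - 1) \<le> 2 * K * cmod (of_real x :: complex)" for h
      using that Kx norm_triangle_ineq[of "h - 1" 1] by (simp add: mult.assoc)
    have bd: "cmod (c j * h) \<le> 2 * B * 2 ^ nat \<bar>j\<bar>" if "cmod h \<le> 2" for j h
      using mult_mono[OF B(2)[of j] that] B(1) by (simp add: norm_mult mult_ac)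
    have P: "cmod (P m x) \<le> 2 * B * 2 ^ m" for m
      unfolding P_def
      using bd[OF F[OF hypergeom_F_near_one[of \<alpha> \<beta> _ m, folded K_def, OF Kx]], of "int m"] by simp
    have N: "cmod (N m x) \<le> 2 * B * 2 ^ m" for m
      unfolding N_def
      using bd[OF F[OF hypergeom_F_near_one[of \<beta> \<alpha> _ m, unfolded mult.commute[of "1 + cmod \<beta>"],
        folded K_def, OF Kx]], of "- int m"] B(1) by simp
    have z2: "2 * cmod z \<le> 1 / 2" "2 * cmod (cnj z) \<le> 1 / 2" using z4 by auto
    note rP = power_series_remainder[OF P _ z2(1), of k]
    note rN = power_series_remainder[OF N _ z2(2), of k]
    have "(\<Sum>m. N m x * cnj z ^ m) = (\<Sum>m. N (Suc m) x * cnj z ^ Suc m)"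
      using suminf_split_head[OF summable_geometric_majorant[OF N _ z2(2)]] by (simp add: N_def)
    then have "ab_expansion \<alpha> \<beta> c z = (\<Sum>m. P m x * z ^ m) + (\<Sum>m. N m x * cnj z ^ m)"
      by (simp add: ab_expansion_def P_def N_def x_def Let_def)
    then have "cmod (ab_expansion \<alpha> \<beta> c z
        - ((\<Sum>m\<le>k. P m x * z ^ m) + (\<Sum>m\<le>k. N m x * cnj z ^ m)))
      \<le> cmod ((\<Sum>m. P m x * z ^ m) - (\<Sum>m\<le>k. P m x * z ^ m))
        + cmod ((\<Sum>m. N m x * cnj z ^ m) - (\<Sum>m\<le>k. N m x * cnj z ^ m))"
      by (simp only: add_diff_add norm_triangle_ineq)
    also have "\<dots> \<le> 2 * (2 * B) * (2 * cmod z) ^ Suc k + 2 * (2 * B) * (2 * cmod z) ^ Suc k"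
      using rP rN by (intro add_mono) auto
    finally show "cmod (ab_expansion \<alpha> \<beta> c z
        - ((\<Sum>m\<le>k. P m ((cmod z)\<^sup>2) * z ^ m) + (\<Sum>m\<le>k. N m ((cmod z)\<^sup>2) * cnj z ^ m)))
      \<le> 2 * (2 * (2 * B) * 2 ^ Suc k) * cmod z ^ Suc k"
      by (simp add: x_def power_mult_distrib mult_ac)
  qed
qed

section \<open>Truncation of the kernel near the origin\<close>

lemma powr_binomial_series:
  assumes "cmod z < 1"
  shows "(1 - z) powr (- s) = (\<Sum>n. pochhammer s n / fact n * z ^ n)"
proof -
  have "(\<lambda>n. (- s gchoose n) * (- z) ^ n) sums (1 + - z) powr (- s)"
    using assms by (intro gen_binomial_complex) auto
  moreover have "(- s gchoose n) * (- z) ^ n = pochhammer s n / fact n * z ^ n" for n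
  proof -
    \<comment> \<open>One sign (-1)^n comes from writing the binomial coefficient as a Pochhammer
      symbol, the other from (-z)^n; they cancel.\<close>
    have "(- s gchoose n) * (- z) ^ n = ((- 1) * (- 1)) ^ n * (pochhammer s n / fact n * z ^ n)"
      unfolding power_mult_distrib power_minus[of z] gbinomial_pochhammer by (simp add: mult_ac)
    then show ?thesis by simp
  qed
  ultimately show ?thesis
    by (simp add: sums_iff)
qed

lemma powr_binomial_remainder:
  assumes "1 + cmod s \<le> R" and "R * cmod z \<le> 1 / 2"
  shows "cmod ((1 - z) powr (- s) - (\<Sum>n\<le>k. pochhammer s n / fact n * z ^ n))
    \<le> 2 * (R * cmod z) ^ Suc k"
proof -
  have R: "1 \<le> R" using assms(1) norm_ge_zero[of s] by linarith
  have "cmod z < 1"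
    using assms R mult_right_mono[of 1 R "cmod z"] by simp
  moreover have "cmod (pochhammer s n / fact n) \<le> 1 * R ^ n" for n
    using norm_pochhammer_div_fact_le[of s n] power_mono[OF assms(1), of n] by simp
  ultimately show ?thesis
    using power_series_remainder[of "\<lambda>n. pochhammer s n / fact n" 1 R z k] assms R
    by (simp add: powr_binomial_series)
qed

text \<open>Only the two binomial powers are truncated. The power of 1 - |z|^2 is kept exactly,
  being constant on circles about the origin; the condition on Re (\<alpha> + \<beta>) makes its
  exponent have positive real part, so its modulus is at most 1.\<close>

lemma ab_kernel_remainder:
  fixes \<alpha> \<beta> :: complex and k :: nat
  defines "R \<equiv> 1 + cmod (\<alpha> + 1) + cmod (\<beta> + 1)"
  assumes Re: "Re (\<alpha> + \<beta>) > -1"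
  obtains M where "0 \<le> M" and "\<And>z. R * cmod z \<le> 1 / 2 \<Longrightarrow>
    cmod (ab_kernel \<alpha> \<beta> z - c_const \<alpha> \<beta> * of_real (1 - (cmod z)\<^sup>2) powr (\<alpha> + \<beta> + 1) *
      ((\<Sum>m\<le>k. pochhammer (\<alpha> + 1) m / fact m * z ^ m) *
       (\<Sum>n\<le>k. pochhammer (\<beta> + 1) n / fact n * cnj z ^ n))) \<le> M * cmod z ^ Suc k"
proof (rule that[of "cmod (c_const \<alpha> \<beta>) * (10 * R ^ Suc k)"])
  have R: "1 \<le> R" by (simp add: R_def)
  then show "0 \<le> cmod (c_const \<alpha> \<beta>) * (10 * R ^ Suc k)" by simp
  fix z assume z: "R * cmod z \<le> 1 / 2"
  define x where "x = R * cmod z"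
  have x: "0 \<le> x" "x \<le> 1 / 2" using z R by (auto simp: x_def)
  have "cmod z \<le> x" unfolding x_def using R mult_right_mono[of 1 R "cmod z"] by simp
  then have z1: "cmod z \<le> 1" using x by simp
  define a where "a = (1 - z) powr (- (\<alpha> + 1))"
  define b where "b = (1 - cnj z) powr (- (\<beta> + 1))"
  define A where "A = (\<Sum>m\<le>k. pochhammer (\<alpha> + 1) m / fact m * z ^ m)"
  define A' where "A' = (\<Sum>n\<le>k. pochhammer (\<beta> + 1) n / fact n * cnj z ^ n)"
  define s where "s = complex_of_real (1 - (cmod z)\<^sup>2) powr (\<alpha> + \<beta> + 1)"
  have RR: "1 + cmod (\<alpha> + 1) \<le> R" "1 + cmod (\<beta> + 1) \<le> R" by (auto simp: R_def)
  have zc: "R * cmod (cnj z) \<le> 1 / 2" using z by simp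
  have aA: "cmod (a - A) \<le> 2 * x ^ Suc k"
    using powr_binomial_remainder[OF RR(1) z, of k] by (simp add: a_def A_def x_def)
  have bA: "cmod (b - A') \<le> 2 * x ^ Suc k"
    using powr_binomial_remainder[OF RR(2) zc, of k] by (simp add: b_def A'_def x_def)
  have a2: "cmod a \<le> 2"
    using powr_binomial_remainder[OF RR(1) z, of 0] x norm_triangle_ineq[of "a - 1" 1]
    by (simp add: a_def x_def)
  have b2: "cmod b \<le> 2"
    using powr_binomial_remainder[OF RR(2) zc, of 0] x norm_triangle_ineq[of "b - 1" 1]
    by (simp add: b_def x_def)
  have "x ^ Suc k \<le> x ^ 1" using x by (intro power_decreasing) auto
  then have A3: "cmod A \<le> 3"
    using aA a2 x norm_triangle_ineq[of "A - a" a] by (simp add: norm_minus_commute)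
  have s1: "cmod s \<le> 1"
  proof -
    have "(cmod z)\<^sup>2 \<le> 1" using z1 by (simp add: power_le_one)
    then have "cmod s = (1 - (cmod z)\<^sup>2) powr Re (\<alpha> + \<beta> + 1)"
      unfolding s_def by (subst norm_powr_real_powr) (auto simp del: of_real_diff)
    also have "\<dots> \<le> 1"
      using Re \<open>(cmod z)\<^sup>2 \<le> 1\<close> by (intro powr_le1) auto
    finally show ?thesis .
  qed
  have "ab_kernel \<alpha> \<beta> z = c_const \<alpha> \<beta> * s * (a * b)"
    unfolding ab_kernel_def a_def b_def s_def powr_minus by (simp add: field_simps)
  then have "ab_kernel \<alpha> \<beta> z - c_const \<alpha> \<beta> * s * (A * A')
      = c_const \<alpha> \<beta> * s * ((a - A) * b + A * (b - A'))"
    by (simp add: algebra_simps)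
  \<comment> \<open>The constant 10 is 2 * 2 + 3 * 2: each binomial power differs from its
    truncation by at most 2 x^(k+1), b has modulus at most 2 (the remainder estimate with k = 0),
    and A has modulus at most 3.\<close>
  also have "cmod \<dots> \<le> cmod (c_const \<alpha> \<beta>) * 1 * (2 * x ^ Suc k * 2 + 3 * (2 * x ^ Suc k))"
    unfolding norm_mult
  proof (intro mult_mono order.trans[OF norm_triangle_ineq add_mono])
    show "cmod ((a - A) * b) \<le> 2 * x ^ Suc k * 2"
      unfolding norm_mult by (rule mult_mono[OF aA b2]) (use x in auto)
    show "cmod (A * (b - A')) \<le> 3 * (2 * x ^ Suc k)"
      unfolding norm_mult by (rule mult_mono[OF A3 bA]) auto
  qed (use s1 in auto)
  finally show "cmod (ab_kernel \<alpha> \<beta> z - c_const \<alpha> \<beta> *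
      of_real (1 - (cmod z)\<^sup>2) powr (\<alpha> + \<beta> + 1) *
      ((\<Sum>m\<le>k. pochhammer (\<alpha> + 1) m / fact m * z ^ m) *
       (\<Sum>n\<le>k. pochhammer (\<beta> + 1) n / fact n * cnj z ^ n)))
    \<le> cmod (c_const \<alpha> \<beta>) * (10 * R ^ Suc k) * cmod z ^ Suc k"
    by (simp add: A_def A'_def s_def x_def power_mult_distrib mult_ac)
qed

subsection \<open>Comparison of coefficients\<close>

text \<open>Integrate against the exponential of frequency -k. For m and n between 0 and k, the
  difference m - n equals k only at m = k, n = 0, so orthogonality isolates that one
  coefficient.\<close>

lemma trig_polynomial_coeff_bound:
  fixes d :: "nat \<Rightarrow> nat \<Rightarrow> complex"
  assumes E: "\<And>\<theta>. cmod (\<Sum>m\<le>k. \<Sum>n\<le>k. d m n * cis ((real m - real n) * \<theta>)) \<le> E"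
  shows "cmod (d k 0) \<le> E"
proof -
  have cis: "((\<lambda>\<theta>. cis (of_int j * \<theta>)) has_integral (if j = 0 then 2 * pi else 0)) {0..2*pi}"
    for j :: int
  proof (cases "j = 0")
    case True
    then show ?thesis
      using has_integral_const_real[of "1::complex" 0 "2*pi"] by (simp add: scaleR_conv_of_real)
  next
    case False
    define c where "c = \<i> * of_int j"
    have c: "c \<noteq> 0" "cis (of_int j * \<theta>) = exp (c * of_real \<theta>)" for \<theta>
      using False by (auto simp: c_def cis_conv_exp mult_ac)
    have "((\<lambda>\<theta>. exp (c * of_real \<theta>) / c) has_vector_derivative exp (c * of_real x)) (at x within {0..2*pi})" for x
      using c(1) by (intro has_vector_derivative_real_field) (auto intro!: derivative_eq_intros)
    then have "((\<lambda>\<theta>. cis (of_int j * \<theta>)) has_integral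
        (cis (of_int j * (2 * pi)) / c - cis (of_int j * 0) / c)) {0..2*pi}"
      unfolding c(2) by (intro fundamental_theorem_of_calculus) auto
    moreover have "cis (of_int j * (2 * pi)) = 1"
      using cis_multiple_2pi[of "of_int j"] by (simp add: mult_ac)
    ultimately show ?thesis using False by simp
  qed
  define h where "h \<theta> = (\<Sum>m\<le>k. \<Sum>n\<le>k. d m n * cis ((real m - real n) * \<theta>)) * cis (- (real k * \<theta>))" for \<theta>
  have h: "h = (\<lambda>\<theta>. \<Sum>m\<le>k. \<Sum>n\<le>k. d m n * cis (of_int (int m - int n - int k) * \<theta>))"
    unfolding h_def sum_distrib_right
    by (intro ext sum.cong refl) (simp add: cis_mult mult.assoc algebra_simps)
  have "(h has_integral
      (\<Sum>m\<le>k. \<Sum>n\<le>k. d m n * (if int m - int n - int k = 0 then 2 * pi else 0))) {0..2*pi}"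
    unfolding h by (intro has_integral_sum has_integral_mult_right cis) auto
  moreover have "(\<Sum>m\<le>k. \<Sum>n\<le>k. d m n * (if int m - int n - int k = 0 then 2 * pi else 0))
      = (\<Sum>m\<le>k. \<Sum>n\<le>k. if m = k \<and> n = 0 then d m n * (2 * pi) else 0)"
    by (intro sum.cong refl) auto
  moreover have "\<dots> = (\<Sum>m\<le>k. if m = k then (\<Sum>n\<le>k. if n = 0 then d m n * (2 * pi) else 0) else 0)"
    by (intro sum.cong refl) auto
  ultimately have "(h has_integral (d k 0 * (2 * pi))) {0..2*pi}"
    by simp
  moreover have "cmod (h \<theta>) \<le> E" for \<theta>
    using E[of \<theta>] by (simp add: h_def norm_mult)
  moreover have "0 \<le> E" using E[of 0] norm_ge_zero order_trans by blast
  ultimately have "cmod (d k 0 * (2 * pi)) \<le> E * (2 * pi)"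
    using has_integral_bound_real[of E "{}" h "d k 0 * (2 * pi)" 0 "2*pi"] by auto
  then show ?thesis by (simp add: norm_mult)
qed

definition fourier_coeff :: "(real \<Rightarrow> complex) \<Rightarrow> int \<Rightarrow> complex" where
  "fourier_coeff g j = 1 / (2 * pi) * (LINT t|lebesgue_on {0..2*pi}. cis (- (of_int j * t)) * g t)"

lemma integrable_continuous_mult:
  fixes h g :: "real \<Rightarrow> complex"
  assumes h: "continuous_on {a..b} h" and g: "integrable (lebesgue_on {a..b}) g"
  shows "integrable (lebesgue_on {a..b}) (\<lambda>t. h t * g t)"
proof -
  have "compact (h ` {a..b})" by (intro compact_continuous_image h) auto
  then obtain B where B: "\<And>t. t \<in> {a..b} \<Longrightarrow> cmod (h t) \<le> B"
    using compact_imp_bounded bounded_iff by (metis imageI)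
  have [measurable]: "h \<in> borel_measurable (lebesgue_on {a..b})"
    by (rule continuous_imp_measurable_on_sets_lebesgue[OF h]) auto
  have [measurable]: "g \<in> borel_measurable (lebesgue_on {a..b})" using g by auto
  show ?thesis
  proof (rule Bochner_Integration.integrable_bound)
    show "integrable (lebesgue_on {a..b}) (\<lambda>t. B * cmod (g t))" using g by auto
    show "AE t in lebesgue_on {a..b}. cmod (h t * g t) \<le> norm (B * cmod (g t))"
    proof (rule AE_I2)
      fix t assume "t \<in> space (lebesgue_on {a..b})"
      then have "cmod (h t) \<le> B" using B by (simp add: space_restrict_space)
      then have "cmod (h t) * cmod (g t) \<le> \<bar>B\<bar> * cmod (g t)"
        by (intro mult_right_mono) auto
      then show "cmod (h t * g t) \<le> norm (B * cmod (g t))" by (simp add: norm_mult abs_mult)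
    qed
  qed (intro borel_measurable_times, measurable)
qed

text \<open>Rotating z by cis (- t) preserves |z| and multiplies z^m times the n-th power of the
  conjugate by cis (- (m - n) t). Integrating the truncated kernel against f therefore produces
  Fourier coefficients, and the error is the kernel error times the mean of |f|.\<close>

lemma ab_Poisson_remainder:
  fixes \<alpha> \<beta> :: complex and k :: nat and f :: "complex \<Rightarrow> complex"
  defines "R \<equiv> 1 + cmod (\<alpha> + 1) + cmod (\<beta> + 1)"
  assumes Re: "Re (\<alpha> + \<beta>) > -1"
    and f: "integrable (lebesgue_on {0..2*pi}) (\<lambda>t. f (cis t))"
  obtains M where "\<And>z. R * cmod z \<le> 1 / 2 \<Longrightarrow>
    cmod (ab_Poisson \<alpha> \<beta> f z - c_const \<alpha> \<beta> * of_real (1 - (cmod z)\<^sup>2) powr (\<alpha> + \<beta> + 1) *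
      (\<Sum>m\<le>k. \<Sum>n\<le>k. pochhammer (\<alpha> + 1) m / fact m * (pochhammer (\<beta> + 1) n / fact n) *
        fourier_coeff (\<lambda>t. f (cis t)) (int m - int n) * z ^ m * cnj z ^ n)) \<le> M * cmod z ^ Suc k"
proof -
  obtain M where M: "0 \<le> M" "\<And>z. R * cmod z \<le> 1 / 2 \<Longrightarrow>
    cmod (ab_kernel \<alpha> \<beta> z - c_const \<alpha> \<beta> * of_real (1 - (cmod z)\<^sup>2) powr (\<alpha> + \<beta> + 1) *
      ((\<Sum>m\<le>k. pochhammer (\<alpha> + 1) m / fact m * z ^ m) *
       (\<Sum>n\<le>k. pochhammer (\<beta> + 1) n / fact n * cnj z ^ n))) \<le> M * cmod z ^ Suc k"
    using ab_kernel_remainder[OF Re, of k] unfolding R_def by blast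
  define L where "L = lebesgue_on {0..2*pi}"
  define g where "g t = f (cis t)" for t
  have g: "integrable L g" using f by (simp add: L_def g_def[abs_def])
  define a where "a m = pochhammer (\<alpha> + 1) m / fact m" for m
  define b where "b m = pochhammer (\<beta> + 1) m / fact m" for m
  show thesis
  proof (rule that[of "M * (1 / (2 * pi) * (LINT t|L. cmod (g t)))"])
    fix z assume z: "R * cmod z \<le> 1 / 2"
    define s where "s = c_const \<alpha> \<beta> * of_real (1 - (cmod z)\<^sup>2) powr (\<alpha> + \<beta> + 1)"
    have "1 \<le> R" by (simp add: R_def)
    then have z1: "cmod z < 1" using z mult_right_mono[of 1 R "cmod z"] by simp
    define Q where "Q t = (\<Sum>m\<le>k. \<Sum>n\<le>k. a m * b n * z ^ m * cnj z ^ n * cis (- (of_int (int m - int n) * t)))" for t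
    have Q: "Q t = (\<Sum>m\<le>k. a m * (z * cis (- t)) ^ m) * (\<Sum>n\<le>k. b n * cnj (z * cis (- t)) ^ n)" for t
      unfolding Q_def sum_product
    proof (intro sum.cong refl)
      fix m n
      have "cis (- (of_int (int m - int n) * t)) = cis (- t) ^ m * cis t ^ n"
        by (simp add: Complex.DeMoivre cis_mult algebra_simps)
      then show "a m * b n * z ^ m * cnj z ^ n * cis (- (of_int (int m - int n) * t)) =
         a m * (z * cis (- t)) ^ m * (b n * cnj (z * cis (- t)) ^ n)"
        by (simp add: power_mult_distrib cis_cnj mult_ac)
    qed
    define K where "K t = ab_kernel \<alpha> \<beta> (z * cis (- t))" for t
    \<comment> \<open>Both bases 1 - w with |w| < 1 are nonzero and have nonnegative real part, so
      they stay off the branch cut of the principal power; the numerator does not depend on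
      t.\<close>
    have cK: "continuous_on {0..2*pi} K"
    proof -
      have n1: "cmod (z * cis (- t)) < 1" "cmod (cnj (z * cis (- t))) < 1" for t
        using z1 by (auto simp: norm_mult)
      have ne: "1 - w \<noteq> 0" if "cmod w < 1" for w
        using that by auto
      have Re: "Re (1 - w) \<ge> 0" if "cmod w < 1" for w
        using that complex_Re_le_cmod[of w] by simp
      have K: "K t = c_const \<alpha> \<beta> * (of_real (1 - (cmod z)\<^sup>2) powr (\<alpha> + \<beta> + 1) /
          ((1 - z * cis (- t)) powr (\<alpha> + 1) * (1 - cnj (z * cis (- t))) powr (\<beta> + 1)))" for t
        by (simp add: K_def ab_kernel_def norm_mult)
      show ?thesis
        unfolding K
        by (intro continuous_on_mult continuous_on_divide continuous_on_powr_complex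
            continuous_on_const continuous_on_diff continuous_on_cnj continuous_on_cis
            continuous_on_minus continuous_on_id ballI)
          (use ne[OF n1(1)] ne[OF n1(2)] Re[OF n1(1)] Re[OF n1(2)] in \<open>auto simp del: complex_cnj_mult minus_complex.simps\<close>)
    qed
    have cQ: "continuous_on {0..2*pi} (\<lambda>t. s * Q t)"
      unfolding Q_def by (intro continuous_intros)
    have iK: "integrable L (\<lambda>t. K t * g t)"
      unfolding L_def by (rule integrable_continuous_mult[OF cK g[unfolded L_def]])
    have iQ: "integrable L (\<lambda>t. s * Q t * g t)"
      unfolding L_def by (rule integrable_continuous_mult[OF cQ g[unfolded L_def]])
    have icis: "integrable L (\<lambda>t. cis (- (of_int j * t)) * g t)" for j
      unfolding L_def by (rule integrable_continuous_mult[OF _ g[unfolded L_def]]) (intro continuous_intros)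
    have "(LINT t|L. s * Q t * g t) = s * (\<Sum>m\<le>k. \<Sum>n\<le>k. a m * b n * z ^ m * cnj z ^ n *
        (LINT t|L. cis (- (of_int (int m - int n) * t)) * g t))"
      using icis by (simp add: Q_def sum_distrib_right mult.assoc del: of_int_diff)
    then have Qs: "1 / (2 * pi) * (LINT t|L. s * Q t * g t) =
      s * (\<Sum>m\<le>k. \<Sum>n\<le>k. a m * b n * fourier_coeff g (int m - int n) * z ^ m * cnj z ^ n)"
      by (simp add: fourier_coeff_def L_def sum_distrib_left mult_ac)
    have "cmod ((LINT t|L. K t * g t) - (LINT t|L. s * Q t * g t)) = cmod (LINT t|L. (K t - s * Q t) * g t)"
      using iK iQ by (simp add: left_diff_distrib)
    also have "\<dots> \<le> (LINT t|L. M * cmod z ^ Suc k * cmod (g t))"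
    proof (rule Bochner_Integration.integral_norm_bound_integral)
      show "cmod ((K t - s * Q t) * g t) \<le> M * cmod z ^ Suc k * cmod (g t)" for t
        using M(2)[of "z * cis (- t)"] z
        by (auto simp: norm_mult Q K_def s_def a_def b_def intro!: mult_right_mono)
    qed (use iK iQ g in \<open>auto simp: left_diff_distrib\<close>)
    finally have "cmod (1 / (2 * pi)) * cmod ((LINT t|L. K t * g t) - (LINT t|L. s * Q t * g t))
        \<le> cmod (1 / (2 * pi)) * (M * cmod z ^ Suc k * (LINT t|L. cmod (g t)))"
      by (intro mult_left_mono) auto
    moreover have "1 / (2 * pi) * (LINT t|L. K t * g t) = ab_Poisson \<alpha> \<beta> f z"
      by (simp add: ab_Poisson_def L_def K_def g_def)
    ultimately have "cmod (ab_Poisson \<alpha> \<beta> f z -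
        s * (\<Sum>m\<le>k. \<Sum>n\<le>k. a m * b n * fourier_coeff g (int m - int n) * z ^ m * cnj z ^ n))
      \<le> M * (1 / (2 * pi) * (LINT t|L. cmod (g t))) * cmod z ^ Suc k"
      unfolding Qs[symmetric] norm_mult[symmetric] right_diff_distrib
      by (simp add: norm_divide mult_ac)
    then show "cmod (ab_Poisson \<alpha> \<beta> f z - c_const \<alpha> \<beta> * of_real (1 - (cmod z)\<^sup>2) powr (\<alpha> + \<beta> + 1) *
      (\<Sum>m\<le>k. \<Sum>n\<le>k. pochhammer (\<alpha> + 1) m / fact m * (pochhammer (\<beta> + 1) n / fact n) *
        fourier_coeff (\<lambda>t. f (cis t)) (int m - int n) * z ^ m * cnj z ^ n))
      \<le> M * (1 / (2 * pi) * (LINT t|L. cmod (g t))) * cmod z ^ Suc k"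
      by (simp add: s_def a_def b_def g_def[abs_def])
  qed
qed

text \<open>Dividing the estimate by r^k leaves an error M r, which vanishes as r tends to 0 from
  the right. In the application F is a hypergeometric factor and s is the radial factor of the
  kernel including its constant.\<close>

lemma scaled_coeff_limit_unique:
  fixes F s :: "real \<Rightarrow> complex"
  assumes "0 < \<delta>" and bd: "\<And>r. 0 < r \<Longrightarrow> r \<le> \<delta> \<Longrightarrow> cmod (of_real r ^ k * (a * F r - s r * b)) \<le> M * r ^ Suc k"
    and "(F \<longlongrightarrow> 1) (at_right 0)" and "(s \<longlongrightarrow> s0) (at_right 0)"
  shows "a = s0 * b"
proof -
  have "((\<lambda>r. a * F r - s r * b) \<longlongrightarrow> 0) (at_right 0)"
  proof (rule Lim_null_comparison)
    show "\<forall>\<^sub>F r in at_right 0. cmod (a * F r - s r * b) \<le> M * r"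
      using eventually_at_right_real[OF \<open>0 < \<delta>\<close>]
    proof eventually_elim
      case (elim r)
      then have "r ^ k * cmod (a * F r - s r * b) \<le> r ^ k * (M * r)"
        using bd[of r] by (simp add: norm_mult norm_power mult_ac)
      then show ?case using elim by simp
    qed
    show "((\<lambda>r. M * r) \<longlongrightarrow> 0) (at_right 0)" by (auto intro!: tendsto_eq_intros)
  qed
  then have "a * 1 - s0 * b = 0"
    using assms(3,4)
    by (intro tendsto_unique[OF trivial_limit_at_right_real, where f = "\<lambda>r. a * F r - s r * b"]
      tendsto_intros)
  then show ?thesis by simp
qed

lemma hypergeom_F_tendsto_one:
  "((\<lambda>r. hypergeom_F (- a) (of_nat m - b) (of_nat m + 1) (of_real (r\<^sup>2))) \<longlongrightarrow> 1) (at_right 0)"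
proof (rule LIM_zero_cancel, rule Lim_null_comparison)
  define K where "K = (1 + cmod a) * (1 + cmod b)"
  have "((\<lambda>r::real. K * r\<^sup>2) \<longlongrightarrow> 0) (at_right 0)" by (auto intro!: tendsto_eq_intros)
  then have "\<forall>\<^sub>F r::real in at_right 0. K * r\<^sup>2 < 1 / 2" by (rule order_tendstoD) auto
  then show "\<forall>\<^sub>F r in at_right 0.
      cmod (hypergeom_F (- a) (of_nat m - b) (of_nat m + 1) (of_real (r\<^sup>2)) - 1) \<le> 2 * K * r\<^sup>2"
  proof eventually_elim
    case (elim r)
    then show ?case
      using hypergeom_F_near_one[of a b "of_real (r\<^sup>2)" m] by (simp add: K_def norm_power)
  qed
  show "((\<lambda>r::real. 2 * K * r\<^sup>2) \<longlongrightarrow> 0) (at_right 0)" by (auto intro!: tendsto_eq_intros)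
qed

lemma ab_expansion_coeffs:
  fixes k :: nat
  assumes Re: "Re (\<alpha> + \<beta>) > -1"
    and f: "integrable (lebesgue_on {0..2*pi}) (\<lambda>t. f (cis t))"
    and c: "root_limsup_le_1 c"
    and eq: "\<And>z. z \<in> ball 0 1 \<Longrightarrow> ab_Poisson \<alpha> \<beta> f z = ab_expansion \<alpha> \<beta> c z"
    and k: "1 \<le> k"
  shows "c (int k) = c_const \<alpha> \<beta> * (pochhammer (\<alpha> + 1) k / fact k) *
      fourier_coeff (\<lambda>t. f (cis t)) (int k)"
    and "c (- int k) = c_const \<alpha> \<beta> * (pochhammer (\<beta> + 1) k / fact k) *
      fourier_coeff (\<lambda>t. f (cis t)) (- int k)"
proof -
  define fc where "fc = fourier_coeff (\<lambda>t. f (cis t))"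
  define a where "a m = pochhammer (\<alpha> + 1) m / fact m" for m
  define b where "b m = pochhammer (\<beta> + 1) m / fact m" for m
  define s where "s r = c_const \<alpha> \<beta> * of_real (1 - r\<^sup>2) powr (\<alpha> + \<beta> + 1)" for r
  define F where "F m r = hypergeom_F (- \<alpha>) (of_nat m - \<beta>) (of_nat m + 1) (of_real (r\<^sup>2))" for m and r :: real
  define G where "G m r = hypergeom_F (- \<beta>) (of_nat m - \<alpha>) (of_nat m + 1) (of_real (r\<^sup>2))" for m and r :: real
  define N where "N m r = (if m = 0 then 0 else c (- int m) * G m r)" for m r
  define R where "R = 1 + cmod (\<alpha> + 1) + cmod (\<beta> + 1)"
  have R: "1 \<le> R" by (simp add: R_def)
  obtain M1 where M1: "\<And>z. R * cmod z \<le> 1 / 2 \<Longrightarrow> cmod (ab_Poisson \<alpha> \<beta> f z -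
      s (cmod z) * (\<Sum>m\<le>k. \<Sum>n\<le>k. a m * b n * fc (int m - int n) * z ^ m * cnj z ^ n)) \<le> M1 * cmod z ^ Suc k"
    using ab_Poisson_remainder[OF Re f, of k] unfolding R_def fc_def a_def b_def s_def by blast
  obtain M2 \<delta> where \<delta>: "0 < \<delta>" and M2: "\<And>z. cmod z \<le> \<delta> \<Longrightarrow> cmod (ab_expansion \<alpha> \<beta> c z -
      ((\<Sum>m\<le>k. c (int m) * F m (cmod z) * z ^ m) + (\<Sum>m\<le>k. N m (cmod z) * cnj z ^ m)))
      \<le> M2 * cmod z ^ Suc k"
    using ab_expansion_remainder[OF c, where k = k and \<alpha> = \<alpha> and \<beta> = \<beta>]
    unfolding F_def N_def G_def by blast
  \<comment> \<open>Below this radius both truncations are valid; as R is at least 1, the circle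
    also lies inside the unit disc.\<close>
  define \<eta> where "\<eta> = min \<delta> (1 / (2 * R))"
  have \<eta>: "0 < \<eta>" using \<delta> R by (simp add: \<eta>_def)
  \<comment> \<open>The expansion is spread over the same index square as the truncated Poisson
    integral, supported on the two axes. The origin is not counted twice because N vanishes at index
    0, and for k at least 1 the entries (k, 0) and (0, k) each carry a single term.\<close>
  define u where "u m n r = (if n = 0 then c (int m) * F m r else 0) + (if m = 0 then N n r else 0)" for m n :: nat and r
  define d where "d r m n = r ^ (m + n) * (u m n r - s r * (a m * b n * fc (int m - int n)))" for r :: real and m n
  have bound: "cmod (\<Sum>m\<le>k. \<Sum>n\<le>k. d r m n * cis ((real m - real n) * \<theta>)) \<le> (M1 + M2) * r ^ Suc k"
    if r: "0 < r" "r \<le> \<eta>" for r \<theta>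
  proof -
    define z where "z = r * cis \<theta>"
    have z: "cmod z = r" using r by (simp add: z_def norm_mult)
    have Rr: "R * r \<le> 1 / 2" "r \<le> \<delta>" using r R by (auto simp: \<eta>_def field_simps)
    moreover have "1 * r \<le> R * r" using R r by (intro mult_right_mono) auto
    ultimately have "r < 1" by simp
    then have zb: "z \<in> ball 0 1" using z by simp
    have zz: "z ^ m * cnj z ^ n = r ^ (m + n) * cis ((real m - real n) * \<theta>)" for m n
      by (simp add: z_def power_mult_distrib cis_cnj Complex.DeMoivre cis_mult power_add algebra_simps)
    have split: "(\<Sum>m\<le>k. c (int m) * F m r * z ^ m) + (\<Sum>m\<le>k. N m r * cnj z ^ m)
        = (\<Sum>m\<le>k. \<Sum>n\<le>k. u m n r * (z ^ m * cnj z ^ n))"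
    proof -
      have "(\<Sum>m\<le>k. \<Sum>n\<le>k. u m n r * (z ^ m * cnj z ^ n)) =
          (\<Sum>m\<le>k. \<Sum>n\<le>k. if n = 0 then c (int m) * F m r * z ^ m else 0)
          + (\<Sum>m\<le>k. \<Sum>n\<le>k. if m = 0 then N n r * cnj z ^ n else 0)"
        unfolding sum.distrib[symmetric] by (intro sum.cong refl) (auto simp: u_def distrib_right)
      also have "(\<Sum>m\<le>k. \<Sum>n\<le>k. if m = 0 then N n r * cnj z ^ n else 0)
          = (\<Sum>m\<le>k. if m = 0 then (\<Sum>n\<le>k. N n r * cnj z ^ n) else 0)"
        by (intro sum.cong refl) auto
      finally show ?thesis by simp
    qed
    have "(\<Sum>m\<le>k. \<Sum>n\<le>k. d r m n * cis ((real m - real n) * \<theta>))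
      = (\<Sum>m\<le>k. \<Sum>n\<le>k. u m n r * (z ^ m * cnj z ^ n))
        - s r * (\<Sum>m\<le>k. \<Sum>n\<le>k. a m * b n * fc (int m - int n) * z ^ m * cnj z ^ n)"
      unfolding sum_distrib_left sum_subtractf[symmetric] mult.assoc zz d_def
      by (intro sum.cong refl) (simp add: algebra_simps)
    also have "\<dots> = (ab_Poisson \<alpha> \<beta> f z
          - s (cmod z) * (\<Sum>m\<le>k. \<Sum>n\<le>k. a m * b n * fc (int m - int n) * z ^ m * cnj z ^ n))
        - (ab_expansion \<alpha> \<beta> c z -
          ((\<Sum>m\<le>k. c (int m) * F m (cmod z) * z ^ m) + (\<Sum>m\<le>k. N m (cmod z) * cnj z ^ m)))"
      using eq[OF zb] by (simp add: z split)
    also have "cmod \<dots> \<le> M1 * r ^ Suc k + M2 * r ^ Suc k"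
      using M1[of z] M2[of z] Rr
      by (intro order.trans[OF norm_triangle_ineq4 add_mono]) (auto simp: z)
    finally show ?thesis by (simp add: distrib_right)
  qed
  have "(s \<longlongrightarrow> c_const \<alpha> \<beta> * of_real (1 - 0\<^sup>2) powr (\<alpha> + \<beta> + 1)) (at_right 0)"
    unfolding s_def by (intro tendsto_intros) auto
  then have s: "(s \<longlongrightarrow> c_const \<alpha> \<beta>) (at_right 0)" by simp
  have "c (int k) = c_const \<alpha> \<beta> * (a k * fc (int k))"
  proof (rule scaled_coeff_limit_unique[OF \<eta> _ _ s])
    show "(F k \<longlongrightarrow> 1) (at_right 0)" unfolding F_def by (rule hypergeom_F_tendsto_one)
    fix r :: real assume r: "0 < r" "r \<le> \<eta>"
    have "cmod (d r k 0) \<le> (M1 + M2) * r ^ Suc k"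
      by (rule trig_polynomial_coeff_bound[OF bound[OF r]])
    then show "cmod (of_real r ^ k * (c (int k) * F k r - s r * (a k * fc (int k)))) \<le> (M1 + M2) * r ^ Suc k"
      using k by (simp add: d_def u_def b_def)
  qed
  then show "c (int k) = c_const \<alpha> \<beta> * (pochhammer (\<alpha> + 1) k / fact k) *
      fourier_coeff (\<lambda>t. f (cis t)) (int k)"
    by (simp add: a_def fc_def)
  have "c (- int k) = c_const \<alpha> \<beta> * (b k * fc (- int k))"
  proof (rule scaled_coeff_limit_unique[OF \<eta> _ _ s])
    show "(G k \<longlongrightarrow> 1) (at_right 0)" unfolding G_def by (rule hypergeom_F_tendsto_one)
    fix r :: real assume r: "0 < r" "r \<le> \<eta>"
    \<comment> \<open>The negative index is reduced to the positive one by transposing the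
      coefficients, which amounts to replacing \<theta> by -\<theta>.\<close>
    have "cmod (d r 0 k) \<le> (M1 + M2) * r ^ Suc k"
    proof (rule trig_polynomial_coeff_bound[where d = "\<lambda>m n. d r n m"])
      fix \<theta>
      have "(\<Sum>m\<le>k. \<Sum>n\<le>k. d r n m * cis ((real m - real n) * \<theta>))
        = (\<Sum>m\<le>k. \<Sum>n\<le>k. d r m n * cis ((real m - real n) * (- \<theta>)))"
        by (subst sum.swap) (simp add: algebra_simps)
      then show "cmod (\<Sum>m\<le>k. \<Sum>n\<le>k. d r n m * cis ((real m - real n) * \<theta>)) \<le> (M1 + M2) * r ^ Suc k"
        using bound[OF r, of "- \<theta>"] by simp
    qed
    then show "cmod (of_real r ^ k * (c (- int k) * G k r - s r * (b k * fc (- int k)))) \<le> (M1 + M2) * r ^ Suc k"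
      using k by (simp add: d_def u_def N_def a_def)
  qed
  then show "c (- int k) = c_const \<alpha> \<beta> * (pochhammer (\<beta> + 1) k / fact k) *
      fourier_coeff (\<lambda>t. f (cis t)) (- int k)"
    by (simp add: b_def fc_def)
qed

subsection \<open>Conjugate exponents on the circle\<close>

abbreviation circ :: "real measure" where "circ \<equiv> lebesgue_on {0..2*pi}"

lemma emeasure_circ: "emeasure circ {0..2*pi} = ennreal (2 * pi)"
  by (simp add: emeasure_restrict_space)

lemma finite_measure_circ: "finite_measure circ"
  by (rule finite_measureI) (simp add: emeasure_circ)

lemma measure_circ: "measure circ {0..2*pi} = 2 * pi"
  by (simp add: measure_def emeasure_circ)

lemma one_divide_ennreal: "0 < b \<Longrightarrow> 1 / ennreal b = ennreal (1 / b)"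
  using divide_ennreal[of 1 b] by simp

text \<open>In \<open>ennreal\<close>, 1 divided by infinity is 0 and 1 divided by 0 is infinity.
  The relation thus excludes q = 0 and forces the endpoint pairs; for the remaining real exponents
  both reciprocals are positive with sum 1, so both exponents exceed 1.\<close>

lemma conjugate_exponents_cases:
  fixes p q :: ennreal
  assumes "1 \<le> p" and "1 / p + 1 / q = 1"
  obtains "p = \<infinity>" "q = 1" | "p = 1" "q = \<infinity>"
    | a b where "p = ennreal a" "q = ennreal b" "1 < a" "1 < b" "1 / a + 1 / b = 1"
proof (cases p)
  case top
  then have q: "1 / q = 1" using assms(2) by simp
  then have "q = 1"
  proof (cases q)
    case (real b)
    with q have "b \<noteq> 0" by auto
    with real(1) have "0 < b" by simp
    then have "ennreal (1 / b) = ennreal 1"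
      using q real(2) by (simp add: one_divide_ennreal)
    then have "1 / b = 1" using \<open>0 < b\<close> by (subst (asm) ennreal_inj) auto
    then show ?thesis using real(2) by simp
  qed auto
  with top that(1) show thesis by (simp add: infinity_ennreal_def)
next
  case (real a)
  note pa = real(2)
  from real assms(1) have a: "1 \<le> a" by (metis ennreal_1 ennreal_le_iff)
  then have p: "1 / p = ennreal (1 / a)"
    using real(2) by (simp add: one_divide_ennreal)
  show thesis
  proof (cases q)
    case top
    then have "ennreal (1 / a) = ennreal 1" using assms(2) p by simp
    then have "a = 1" using a by (subst (asm) ennreal_inj) auto
    then show thesis using that(2) real top by (simp add: infinity_ennreal_def)
  next
    case (real b)
    have b0: "b \<noteq> 0"
    proof
      assume "b = 0"
      then have "1 / q = top" using real by (simp add: ennreal_divide_zero)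
      then show False using assms(2) by simp
    qed
    then have b: "0 < b" using real by simp
    then have "1 / q = ennreal (1 / b)"
      using real(2) by (simp add: one_divide_ennreal)
    then have "ennreal (1 / a + 1 / b) = ennreal 1"
      using assms(2) p a b by (simp add: ennreal_plus)
    then have ab: "1 / a + 1 / b = 1"
      using a b by (subst (asm) ennreal_inj) auto
    then have "1 / a < 1" "1 / b < 1"
      using a b by (smt (verit) divide_pos_pos)+
    then have "1 < a" "1 < b" using a b by (simp_all add: pos_divide_less_eq)
    show thesis
      by (rule that(3)[OF pa real(2) \<open>1 < a\<close> \<open>1 < b\<close> ab])
  qed
qed

section \<open>Hoelder's inequality for norms normalized by the length of the circle\<close>

lemma in_Lp_measurable:
  "in_Lp p g \<Longrightarrow> (\<lambda>t. norm (g t)) \<in> borel_measurable circ"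
  by (rule measurable_compose[OF _ borel_measurable_norm]) (simp add: in_Lp_def)

lemma Lp_norm_nonneg: "0 \<le> Lp_norm p g"
  by (simp add: Lp_norm_def)

text \<open>Membership in the space is essential: it makes the essential supremum finite, whereas
  \<open>enn2real\<close> would send an infinite one to 0.\<close>

lemma AE_le_Lp_norm_infinity:
  assumes "in_Lp \<infinity> g"
  shows "AE t in circ. norm (g t) \<le> Lp_norm \<infinity> g"
proof -
  have fin: "esssup circ (\<lambda>t. ennreal (norm (g t))) < \<infinity>"
    using assms by (simp add: in_Lp_def)
  have "AE t in circ. ennreal (norm (g t)) \<le> esssup circ (\<lambda>t. ennreal (norm (g t)))"
    by (rule esssup_AE)
  then show ?thesis
  proof eventually_elim
    case (elim t)
    then have "enn2real (ennreal (norm (g t))) \<le> enn2real (esssup circ (\<lambda>t. ennreal (norm (g t))))"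
      using fin by (intro enn2real_mono) auto
    then show ?case by (simp add: Lp_norm_def)
  qed
qed

lemma Hoelder_infinity_one:
  fixes g :: "real \<Rightarrow> 'a::real_normed_vector" and h :: "real \<Rightarrow> 'b::real_normed_vector"
  assumes g: "in_Lp \<infinity> g" and h: "in_Lp 1 h"
  shows "integrable circ (\<lambda>t. norm (g t) * norm (h t))"
    and "1 / (2 * pi) * (LINT t|circ. norm (g t) * norm (h t)) \<le> Lp_norm \<infinity> g * Lp_norm 1 h"
proof -
  note [measurable] = in_Lp_measurable[OF g] in_Lp_measurable[OF h]
  define A where "A = Lp_norm \<infinity> g"
  have "0 \<le> A" by (simp add: A_def Lp_norm_nonneg)
  have h1: "integrable circ (\<lambda>t. norm (h t))"
    using h by (simp add: in_Lp_def)
  have nh: "Lp_norm 1 h = 1 / (2 * pi) * (LINT t|circ. norm (h t))"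
    by (simp add: Lp_norm_def)
  have "AE t in circ. norm (g t) \<le> A"
    unfolding A_def by (rule AE_le_Lp_norm_infinity[OF g])
  then have le: "AE t in circ. norm (g t) * norm (h t) \<le> A * norm (h t)"
    by eventually_elim (auto intro: mult_right_mono)
  show int: "integrable circ (\<lambda>t. norm (g t) * norm (h t))"
  proof (rule Bochner_Integration.integrable_bound)
    show "integrable circ (\<lambda>t. A * norm (h t))" using h1 by simp
    show "AE t in circ. norm (norm (g t) * norm (h t)) \<le> norm (A * norm (h t))"
      using le \<open>0 \<le> A\<close> by (simp add: abs_mult)
  qed measurable
  have "(LINT t|circ. norm (g t) * norm (h t)) \<le> (LINT t|circ. A * norm (h t))"
    using int h1 le by (intro integral_mono_AE) auto
  then have "1 / (2 * pi) * (LINT t|circ. norm (g t) * norm (h t)) \<le> 1 / (2 * pi) * (LINT t|circ. A * norm (h t))"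
    by (intro mult_left_mono) auto
  then show "1 / (2 * pi) * (LINT t|circ. norm (g t) * norm (h t)) \<le> Lp_norm \<infinity> g * Lp_norm 1 h"
    unfolding nh A_def[symmetric] by (simp add: mult_ac)
qed

text \<open>Young's inequality is used twice: applied directly it shows that the product is
  integrable, and applied to the rescaled functions it gives the bound, where the two means
  contribute at most 1/a and 1/b, which add up to 1.\<close>

lemma Hoelder_finite:
  fixes g :: "real \<Rightarrow> 'a::real_normed_vector" and h :: "real \<Rightarrow> 'b::real_normed_vector"
  assumes ab: "1 < a" "1 < b" "1 / a + 1 / b = 1"
    and g: "in_Lp (ennreal a) g" and h: "in_Lp (ennreal b) h"
  shows "integrable circ (\<lambda>t. norm (g t) * norm (h t))"
    and "1 / (2 * pi) * (LINT t|circ. norm (g t) * norm (h t)) \<le> Lp_norm (ennreal a) g * Lp_norm (ennreal b) h"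
proof -
  note [measurable] = in_Lp_measurable[OF g] in_Lp_measurable[OF h]
  define A where "A = Lp_norm (ennreal a) g"
  define B where "B = Lp_norm (ennreal b) h"
  define I where "I = 1 / (2 * pi) * (LINT t|circ. norm (g t) * norm (h t))"
  have AB: "0 \<le> A" "0 \<le> B" by (simp_all add: A_def B_def Lp_norm_nonneg)
  have ig: "integrable circ (\<lambda>t. norm (g t) powr a)" and ih: "integrable circ (\<lambda>t. norm (h t) powr b)"
    using g h ab by (auto simp: in_Lp_def)
  have Ig: "1 / (2 * pi) * (LINT t|circ. norm (g t) powr a) = A powr a"
    using ab by (simp add: A_def Lp_norm_def powr_powr)
  have Ih: "1 / (2 * pi) * (LINT t|circ. norm (h t) powr b) = B powr b"
    using ab by (simp add: B_def Lp_norm_def powr_powr)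
  show int: "integrable circ (\<lambda>t. norm (g t) * norm (h t))"
  proof (rule Bochner_Integration.integrable_bound)
    show "integrable circ (\<lambda>t. norm (g t) powr a / a + norm (h t) powr b / b)" using ig ih by simp
    show "AE t in circ. norm (norm (g t) * norm (h t)) \<le> norm (norm (g t) powr a / a + norm (h t) powr b / b)"
    proof (rule AE_I2)
      fix t
      show "norm (norm (g t) * norm (h t)) \<le> norm (norm (g t) powr a / a + norm (h t) powr b / b)"
        using Youngs_inequality[OF ab, of "norm (g t)" "norm (h t)"] by simp
    qed
  qed measurable
  \<comment> \<open>Normalizing by strictly larger numbers also covers the case of a vanishing norm.\<close>
  have *: "I \<le> x * y" if x: "A < x" and y: "B < y" for x y
  proof -
    have xy: "0 < x" "0 < y" using that AB by auto
    have le: "norm (g t) * norm (h t) \<le> (x * y) * (norm (g t) powr a / (x powr a * a) + norm (h t) powr b / (y powr b * b))" for t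
    proof -
      have "norm (g t) / x * (norm (h t) / y) \<le> (norm (g t) / x) powr a / a + (norm (h t) / y) powr b / b"
        using xy by (intro Youngs_inequality ab) auto
      then have "(x * y) * (norm (g t) / x * (norm (h t) / y)) \<le> (x * y) * ((norm (g t) / x) powr a / a + (norm (h t) / y) powr b / b)"
        using xy by (intro mult_left_mono) auto
      then show ?thesis using xy by (simp add: powr_divide)
    qed
    have "(LINT t|circ. norm (g t) * norm (h t))
      \<le> (LINT t|circ. (x * y) * (norm (g t) powr a / (x powr a * a) + norm (h t) powr b / (y powr b * b)))"
      using int ig ih le by (intro integral_mono) auto
    then have "I \<le> 1 / (2 * pi) * (LINT t|circ. (x * y) * (norm (g t) powr a / (x powr a * a) + norm (h t) powr b / (y powr b * b)))"
      unfolding I_def by (intro mult_left_mono) auto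
    also have "\<dots> = (x * y) * ((1 / (2 * pi) * (LINT t|circ. norm (g t) powr a)) / (x powr a * a)
        + (1 / (2 * pi) * (LINT t|circ. norm (h t) powr b)) / (y powr b * b))"
      using ig ih by (simp add: field_simps)
    also have "\<dots> \<le> (x * y) * (1 / a + 1 / b)"
    proof (intro mult_left_mono add_mono)
      have "A powr a \<le> x powr a" "B powr b \<le> y powr b"
        using that AB ab by (auto intro!: powr_mono2)
      then show "(1 / (2 * pi) * (LINT t|circ. norm (g t) powr a)) / (x powr a * a) \<le> 1 / a"
          "(1 / (2 * pi) * (LINT t|circ. norm (h t) powr b)) / (y powr b * b) \<le> 1 / b"
        unfolding Ig Ih using ab xy by (auto simp: divide_simps)
    qed (use xy in auto)
    finally show ?thesis using ab by simp
  qed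
  have "I \<le> A * B"
  proof (rule tendsto_lowerbound)
    show "((\<lambda>e. (A + e) * (B + e)) \<longlongrightarrow> A * B) (at_right 0)"
      by (auto intro!: tendsto_eq_intros)
    show "\<forall>\<^sub>F e in at_right 0. I \<le> (A + e) * (B + e)"
      using eventually_at_right_less[of 0] by eventually_elim (auto intro: *)
  qed auto
  then show "1 / (2 * pi) * (LINT t|circ. norm (g t) * norm (h t)) \<le> Lp_norm (ennreal a) g * Lp_norm (ennreal b) h"
    by (simp add: I_def A_def B_def)
qed

lemma Hoelder:
  fixes g :: "real \<Rightarrow> 'a::real_normed_vector" and h :: "real \<Rightarrow> 'b::real_normed_vector"
  assumes "1 \<le> p" and "1 / p + 1 / q = 1" and g: "in_Lp p g" and h: "in_Lp q h"
  shows "integrable circ (\<lambda>t. norm (g t) * norm (h t)) \<and>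
    1 / (2 * pi) * (LINT t|circ. norm (g t) * norm (h t)) \<le> Lp_norm p g * Lp_norm q h"
  using assms(1,2)
proof (cases rule: conjugate_exponents_cases)
  case 1
  then show ?thesis using Hoelder_infinity_one[of g h] g h by auto
next
  case 2
  then show ?thesis using Hoelder_infinity_one[of h g] g h by (auto simp: mult.commute)
next
  case (3 a b)
  then show ?thesis using Hoelder_finite[of a b g h] g h by auto
qed

lemma in_Lp_continuous_le_one:
  fixes h :: "real \<Rightarrow> real"
  assumes h: "continuous_on {0..2*pi} h" and le: "\<And>t. \<bar>h t\<bar> \<le> 1"
  shows "in_Lp q h"
proof -
  have m[measurable]: "h \<in> borel_measurable circ"
    by (rule continuous_imp_measurable_on_sets_lebesgue[OF h]) auto
  have "esssup circ (\<lambda>t. ennreal (norm (h t))) \<le> 1"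
    using le by (intro esssup_I AE_I2) (auto simp: ennreal_le_1)
  then have "esssup circ (\<lambda>t. ennreal (norm (h t))) < \<infinity>"
    by (rule order.strict_trans1) simp
  moreover have "integrable circ (\<lambda>t. norm (h t) powr enn2real q)"
    by (rule finite_measure.integrable_const_bound[OF finite_measure_circ, of _ 1])
      (auto intro!: AE_I2 powr_le1 le)
  ultimately show ?thesis by (simp add: in_Lp_def m)
qed

lemma in_Lp_one: "in_Lp q (\<lambda>_. 1 :: real)"
  by (rule in_Lp_continuous_le_one) auto

lemma Lp_norm_one: "Lp_norm q (\<lambda>_. 1 :: real) = 1"
proof -
  have "esssup circ (\<lambda>_. ennreal (norm (1 :: real))) = ennreal (norm (1 :: real))"
    by (rule esssup_const) (simp add: emeasure_circ)
  then show ?thesis by (simp add: Lp_norm_def measure_circ)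
qed

section \<open>Cosines with a phase: periodicity and norms\<close>

text \<open>Let G be an antiderivative of F. Its increment D over one period has derivative 0, hence
  is constant. The substituted integral is (G (2 pi k + \<phi>) - G \<phi>) / k, and the difference
  telescopes into k copies of D 0, the integral of F over one period.\<close>

lemma integral_periodic_affine:
  fixes F :: "real \<Rightarrow> real" and k :: nat
  assumes cont: "continuous_on UNIV F" and per: "\<And>x. F (x + 2 * pi) = F x" and k: "1 \<le> k"
  shows "integral {0..2*pi} (\<lambda>t. F (real k * t + \<phi>)) = integral {0..2*pi} F"
proof -
  \<comment> \<open>An antiderivative is taken on a compact interval only, so it must contain
    [0, 2 pi] and [\<phi>, \<phi> + 2 pi k]. The choice of u also leaves room for one further period
    beyond each point where D is evaluated.\<close>
  define u where "u = \<bar>\<phi>\<bar> + 2 * pi * (real k + 1)"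
  have "continuous_on {-u..u} F" by (rule continuous_on_subset[OF cont]) auto
  then obtain G where G: "\<And>x. x \<in> {-u..u} \<Longrightarrow> (G has_vector_derivative F x) (at x within {-u..u})"
    using antiderivative_continuous by blast
  define D where "D x = G (x + 2 * pi) - G x" for x
  have u: "0 \<le> u" "\<bar>\<phi>\<bar> + 2 * pi * real k + 2 * pi = u" by (auto simp: u_def algebra_simps)
  have sub: "(G has_vector_derivative F x) (at x within S)" if "S \<subseteq> {-u..u}" "x \<in> S" for x S
    using has_vector_derivative_within_subset[OF G] that by blast
  have D: "D x = D y" if "x \<in> {-u..u - 2*pi}" "y \<in> {-u..u - 2*pi}" for x y
  proof (rule has_derivative_zero_unique[OF convex_real_interval(5) _ that])
    fix v assume v: "v \<in> {-u..u - 2*pi}"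
    have "((G \<circ> (\<lambda>x. x + 2 * pi)) has_vector_derivative (1 *\<^sub>R F (v + 2 * pi))) (at v within {-u..u - 2*pi})"
      by (rule vector_diff_chain_within, (auto intro!: derivative_eq_intros)[1], rule sub)
        (use v pi_gt_zero in auto)
    then have "((\<lambda>x. G (x + 2 * pi) - G x) has_vector_derivative (F (v + 2 * pi) - F v)) (at v within {-u..u - 2*pi})"
      unfolding o_def using v pi_gt_zero by (intro has_vector_derivative_diff sub) auto
    then show "(D has_derivative (\<lambda>h. 0)) (at v within {-u..u - 2*pi})"
      by (simp add: per D_def[abs_def] has_vector_derivative_def)
  qed
  have D\<phi>: "D (\<phi> + 2 * pi * real j) = D 0" if "j < k" for j
  proof (rule D)
    have "2 * pi * (real j + 1) \<le> 2 * pi * real k" using that by (intro mult_left_mono) auto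
    then have "2 * pi * real j + 2 * pi \<le> 2 * pi * real k" by (simp add: distrib_left)
    moreover have "0 \<le> 2 * pi * real j" by simp
    ultimately show "\<phi> + 2 * pi * real j \<in> {-u..u - 2*pi}"
      unfolding u(2)[symmetric] atLeastAtMost_iff
      using pi_gt_zero abs_ge_self[of \<phi>] abs_ge_minus_self[of \<phi>] by (intro conjI; linarith)
  next
    have "0 \<le> 2 * pi * real k" by simp
    then show "0 \<in> {-u..u - 2*pi}"
      unfolding u(2)[symmetric] atLeastAtMost_iff
      using pi_gt_zero abs_ge_zero[of \<phi>] by (intro conjI; linarith)
  qed
  have tel: "G (\<phi> + 2 * pi * real j) - G \<phi> = real j * D 0" if "j \<le> k" for j
    using that
  proof (induction j)
    case (Suc j)
    then show ?case using D\<phi>[of j] by (simp add: D_def algebra_simps)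
  qed simp
  have "0 \<le> 2 * pi * real k" by simp
  then have "{0..2*pi} \<subseteq> {-u..u}" using u by auto
  then have "(F has_integral (G (2 * pi) - G 0)) {0..2*pi}"
    by (intro fundamental_theorem_of_calculus sub) auto
  then have I: "integral {0..2*pi} F = D 0" by (simp add: D_def integral_unique)
  have "((\<lambda>t. F (real k * t + \<phi>)) has_integral
      (G (real k * (2 * pi) + \<phi>) / real k - G (real k * 0 + \<phi>) / real k)) {0..2*pi}"
  proof (rule fundamental_theorem_of_calculus)
    fix t assume t: "t \<in> {0..2 * pi}"
    have im: "(\<lambda>t. real k * t + \<phi>) ` {0..2*pi} \<subseteq> {-u..u}"
    proof (rule image_subsetI)
      fix s assume "s \<in> {0..2*pi}"
      then have "0 \<le> real k * s" "real k * s \<le> real k * (2 * pi)"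
        by (auto intro: mult_left_mono)
      then show "real k * s + \<phi> \<in> {-u..u}"
        unfolding u(2)[symmetric] atLeastAtMost_iff
        using pi_gt_zero abs_ge_self[of \<phi>] abs_ge_minus_self[of \<phi>]
        by (simp only: mult_ac) (intro conjI; linarith)
    qed
    have "((G \<circ> (\<lambda>t. real k * t + \<phi>)) has_vector_derivative (real k *\<^sub>R F (real k * t + \<phi>))) (at t within {0..2*pi})"
      by (rule vector_diff_chain_within, (auto intro!: derivative_eq_intros)[1], rule sub)
        (use t im in auto)
    then have "((\<lambda>t. (1 / real k) *\<^sub>R G (real k * t + \<phi>)) has_vector_derivative
        (1 / real k) *\<^sub>R (real k *\<^sub>R F (real k * t + \<phi>))) (at t within {0..2*pi})"
      unfolding o_def by (rule bounded_linear.has_vector_derivative[OF bounded_linear_scaleR_right])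
    moreover have "real k * (inverse (real k) * x) = x" for x using k by simp
    ultimately show "((\<lambda>t. G (real k * t + \<phi>) / real k) has_vector_derivative F (real k * t + \<phi>)) (at t within {0..2*pi})"
      by (simp add: divide_inverse mult_ac)
  qed auto
  then have "integral {0..2*pi} (\<lambda>t. F (real k * t + \<phi>)) = (G (real k * (2 * pi) + \<phi>) - G \<phi>) / real k"
    by (simp add: integral_unique diff_divide_distrib)
  also have "\<dots> = D 0" using tel[of k] k by (simp add: add.commute mult.commute mult.left_commute)
  finally show ?thesis using I by simp
qed

lemma integral_circ_continuous:
  fixes F :: "real \<Rightarrow> real"
  assumes "continuous_on {0..2*pi} F"
  shows "(LINT t|circ. F t) = integral {0..2*pi} F"
  by (intro lebesgue_integral_eq_integral continuous_imp_integrable_real assms) auto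

text \<open>For the lower bound, the set where |cos| is at most the essential supremum is closed by
  continuity and contains almost every point of the open interval, hence all of it, including a
  point where |cos| equals 1.\<close>

lemma Lp_norm_infinity_cos:
  assumes k: "1 \<le> (k :: nat)"
  shows "Lp_norm \<infinity> (\<lambda>t. cos (real k * t + \<phi>)) = 1"
proof -
  define e where "e = esssup circ (\<lambda>t. ennreal (norm (cos (real k * t + \<phi>))))"
  have cont: "continuous_on S (\<lambda>t. cos (real k * t + \<phi>))" for S
    by (intro continuous_intros)
  have [measurable]: "(\<lambda>t. cos (real k * t + \<phi>)) \<in> borel_measurable circ"
    by (rule continuous_imp_measurable_on_sets_lebesgue[OF cont]) auto
  have le: "e \<le> 1"
    unfolding e_def by (intro esssup_I AE_I2) (auto simp: ennreal_le_1)
  then have fin: "e < \<infinity>" by (rule order.strict_trans1) simp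
  have Lp: "Lp_norm \<infinity> (\<lambda>t. cos (real k * t + \<phi>)) = enn2real e"
    by (simp add: Lp_norm_def e_def)
  have Lin: "in_Lp \<infinity> (\<lambda>t. cos (real k * t + \<phi>))"
    by (rule in_Lp_continuous_le_one[OF cont]) simp
  \<comment> \<open>The least integer with n pi > \<phi>. Then n pi - \<phi> lies in (0, pi], so
    dividing by k places t0 strictly inside (0, 2 pi), where k t0 + \<phi> is a multiple of
    pi.\<close>
  define n where "n = \<lfloor>\<phi> / pi\<rfloor> + 1"
  define t0 where "t0 = (of_int n * pi - \<phi>) / real k"
  have n: "of_int n * pi - \<phi> > 0" "of_int n * pi - \<phi> \<le> pi"
  proof -
    have "of_int n - 1 \<le> \<phi> / pi" "\<phi> / pi < of_int n"
      unfolding n_def by linarith+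
    then have "(of_int n - 1) * pi \<le> \<phi>" "\<phi> < of_int n * pi"
      by (simp_all add: pos_le_divide_eq pos_divide_less_eq)
    then show "of_int n * pi - \<phi> > 0" "of_int n * pi - \<phi> \<le> pi"
      by (auto simp: algebra_simps)
  qed
  have "t0 \<le> pi / 1"
    unfolding t0_def using n k by (intro frac_le) auto
  moreover have "t0 > 0" unfolding t0_def using n(1) k by (intro divide_pos_pos) auto
  ultimately have t0: "t0 \<in> {0<..<2*pi}"
    using pi_gt_zero by auto
  have "AE t in circ. norm (cos (real k * t + \<phi>)) \<le> enn2real e"
    using AE_le_Lp_norm_infinity[OF Lin] unfolding Lp .
  then have "AE t in lebesgue. t \<in> {0..2*pi} \<longrightarrow> norm (cos (real k * t + \<phi>)) \<le> enn2real e"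
    by (simp add: AE_restrict_space_iff)
  then have AE: "AE t \<in> {0<..<2*pi} in lebesgue. t \<in> {t. norm (cos (real k * t + \<phi>)) \<le> enn2real e}"
    by eventually_elim auto
  have "t0 \<in> {t. norm (cos (real k * t + \<phi>)) \<le> enn2real e}"
    by (rule mem_closed_if_AE_lebesgue_open[OF _ _ AE t0])
      (auto intro!: closed_Collect_le continuous_intros)
  moreover have "real k * t0 + \<phi> = of_int n * pi" using k by (simp add: t0_def)
  moreover have "\<bar>cos (of_int n * pi)\<bar> = 1"
    using sin_zero_iff_int2[of "of_int n * pi"] sin_zero_abs_cos_one by blast
  ultimately have "1 \<le> enn2real e" by simp
  moreover have "enn2real e \<le> 1"
    using enn2real_mono[OF le] by simp
  ultimately show ?thesis using Lp by simp
qed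

lemma Lp_norm_cos_shift:
  assumes k: "1 \<le> (k :: nat)" and q: "1 \<le> q"
  shows "Lp_norm q (\<lambda>t. cos (real k * t + \<phi>)) = cos_const q k"
proof (cases "q = \<infinity>")
  case True
  then show ?thesis
    using Lp_norm_infinity_cos[OF k, of \<phi>] Lp_norm_infinity_cos[OF k, of 0] by (simp add: cos_const_def)
next
  case False
  define r where "r = enn2real q"
  \<comment> \<open>Positivity of the exponent makes the power of |cos| continuous at the zeros of
    cosine.\<close>
  have r: "0 < r"
    using q False unfolding r_def by (metis enn2real_positive_iff infinity_ennreal_def less_le_trans
      top.not_eq_extremum zero_less_one)
  define F where "F x = \<bar>cos x\<bar> powr r" for x :: real
  have cF: "continuous_on S F" for S
    unfolding F_def using r by (intro continuous_on_powr' continuous_intros) auto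
  have "integral {0..2*pi} (\<lambda>t. F (real k * t + \<phi>)) = integral {0..2*pi} F" for \<phi>
    by (rule integral_periodic_affine[OF cF _ k]) (simp add: F_def)
  moreover have "(LINT t|circ. F (real k * t + \<phi>)) = integral {0..2*pi} (\<lambda>t. F (real k * t + \<phi>))" for \<phi>
    by (intro integral_circ_continuous continuous_on_compose2[OF cF[of UNIV]] continuous_intros) auto
  ultimately have "(LINT t|circ. F (real k * t + \<phi>)) = integral {0..2*pi} F" for \<phi> by simp
  from this[of \<phi>] this[of 0] show ?thesis
    using False by (simp add: cos_const_def Lp_norm_def F_def r_def)
qed

text \<open>A phase shift by pi / 2 replaces |cos (k t)| by |sin|, whose sign pattern on [0, 2 pi]
  changes only at pi; each half contributes 2 to the integral, and 4 / (2 pi) = 2 / pi.\<close>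

lemma cos_const_one:
  assumes k: "1 \<le> k"
  shows "cos_const 1 k = 2 / pi"
proof -
  define F where "F x = \<bar>sin x\<bar>" for x :: real
  have cF: "continuous_on S F" for S unfolding F_def by (intro continuous_intros)
  have "((\<lambda>x. sin x) has_integral (- cos pi - (- cos 0))) {0..pi}"
    by (rule fundamental_theorem_of_calculus)
      (auto intro!: derivative_eq_intros simp: has_real_derivative_iff_has_vector_derivative[symmetric])
  then have "((\<lambda>x. sin x) has_integral 2) {0..pi}" by simp
  then have 1: "(F has_integral 2) {0..pi}"
    by (rule has_integral_eq[rotated]) (auto simp: F_def sin_ge_zero)
  have "((\<lambda>x. - sin x) has_integral (cos (2 * pi) - cos pi)) {pi..2*pi}"
    by (rule fundamental_theorem_of_calculus)
      (auto intro!: derivative_eq_intros simp: has_real_derivative_iff_has_vector_derivative[symmetric])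
  then have "((\<lambda>x. - sin x) has_integral 2) {pi..2*pi}" by simp
  then have 2: "(F has_integral 2) {pi..2*pi}"
  proof (rule has_integral_eq[rotated])
    fix x assume "x \<in> {pi..2*pi}"
    then have "sin (x - pi) \<ge> 0" by (intro sin_ge_zero) auto
    then show "- sin x = F x" by (simp add: F_def sin_diff)
  qed
  have "(F has_integral (2 + 2)) {0..2*pi}"
    by (rule has_integral_combine[OF _ _ 1 2]) auto
  then have "integral {0..2*pi} F = 4" by (simp add: integral_unique)
  moreover have "integral {0..2*pi} (\<lambda>t. F (real k * t + pi / 2)) = integral {0..2*pi} F"
    by (rule integral_periodic_affine[OF cF _ k]) (simp add: F_def)
  moreover have "F (real k * t + pi / 2) = \<bar>cos (real k * t)\<bar>" for t
    by (simp add: F_def sin_add)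
  moreover have "(LINT t|circ. \<bar>cos (real k * t)\<bar>) = integral {0..2*pi} (\<lambda>t. \<bar>cos (real k * t)\<bar>)"
    by (intro integral_circ_continuous continuous_intros)
  ultimately show ?thesis
    by (simp add: cos_const_def Lp_norm_def)
qed

section \<open>Bounds for Fourier coefficients\<close>

lemma norm_cis_add_cis: "cmod (cis x + cis y) = 2 * \<bar>cos ((x - y) / 2)\<bar>"
proof -
  have "cis x + cis y = of_real (2 * cos ((x - y) / 2)) * cis ((x + y) / 2)"
    by (simp add: complex_eq_iff cos_plus_cos sin_plus_sin mult_ac)
  then show ?thesis by (simp add: norm_mult)
qed

lemma in_Lp_imp_integrable:
  fixes g :: "real \<Rightarrow> complex"
  assumes "1 \<le> p" and "1 / p + 1 / q = 1" and g: "in_Lp p g"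
  shows "integrable circ g"
proof -
  have "integrable circ (\<lambda>t. norm (g t) * norm (1 :: real))"
    by (rule conjunct1[OF Hoelder[OF assms(1,2) g in_Lp_one]])
  then have "integrable circ (\<lambda>t. norm (g t))" by simp
  moreover have "g \<in> borel_measurable circ" using g by (simp add: in_Lp_def)
  ultimately show ?thesis by (rule integrable_norm_cancel)
qed

lemma norm_fourier_coeff_le:
  assumes "1 \<le> p" and "1 / p + 1 / q = 1" and g: "in_Lp p g"
  shows "cmod (fourier_coeff g j) \<le> Lp_norm p g"
proof -
  have "cmod (fourier_coeff g j) = 1 / (2 * pi) * cmod (LINT t|circ. cis (- (of_int j * t)) * g t)"
    by (simp add: fourier_coeff_def norm_mult norm_divide)
  also have "\<dots> \<le> 1 / (2 * pi) * (LINT t|circ. norm (cis (- (of_int j * t)) * g t))"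
    by (intro mult_left_mono integral_norm_bound) auto
  also have "\<dots> \<le> Lp_norm p g * Lp_norm q (\<lambda>_. 1 :: real)"
    using conjunct2[OF Hoelder[OF assms(1,2) g in_Lp_one]] by (simp add: norm_mult)
  finally show ?thesis by (simp add: Lp_norm_one)
qed

lemma norm_fourier_coeff_pair_le:
  assumes pq: "1 \<le> p" "1 / p + 1 / q = 1" and g: "in_Lp p g" and k: "1 \<le> k"
  shows "cmod (fourier_coeff g (int k)) + cmod (fourier_coeff g (- int k))
    \<le> 2 * cos_const q k * Lp_norm p g"
proof -
  have q: "1 \<le> q"
    using pq
  proof (cases rule: conjugate_exponents_cases)
    case (3 a b)
    then have "ennreal 1 \<le> ennreal b" by (intro ennreal_leI) simp
    with 3(2) show ?thesis by simp
  qed simp_all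
  define a where "a = Arg (fourier_coeff g (int k))"
  define b where "b = Arg (fourier_coeff g (- int k))"
  define \<phi> where "\<phi> = (a - b) / 2"
  have pol: "cis (- Arg w) * w = of_real (cmod w)" for w
  proof -
    have "cis (- Arg w) * w = cis (- Arg w) * (of_real (cmod w) * cis (Arg w))"
      by (metis rcis_cmod_Arg rcis_def)
    also have "\<dots> = of_real (cmod w)" by (simp add: mult.left_commute cis_mult)
    finally show ?thesis .
  qed
  \<comment> \<open>The rotations by -a and -b turn the two Fourier coefficients into their moduli,
    so h is the function whose mean against g is the sum of the moduli. Its exponentials have
    opposite frequencies, and half the difference of their arguments is -(k t + \<phi>), which
    explains the choice of \<phi>.\<close>
  define h where "h t = cis (- a - real k * t) + cis (- b + real k * t)" for t
  have ig: "integrable circ g" by (rule in_Lp_imp_integrable[OF pq g])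
  have i: "integrable circ (\<lambda>t. cis (x * t) * g t)" for x :: real
    by (rule integrable_continuous_mult[OF _ ig]) (intro continuous_intros)
  have hg: "h t * g t = cis (- a) * (cis (- real k * t) * g t) + cis (- b) * (cis (real k * t) * g t)" for t
    unfolding h_def by (simp add: distrib_right cis_mult mult.assoc[symmetric])
  have "of_real (cmod (fourier_coeff g (int k)) + cmod (fourier_coeff g (- int k)))
      = cis (- a) * fourier_coeff g (int k) + cis (- b) * fourier_coeff g (- int k)"
    unfolding a_def b_def pol by simp
  also have "\<dots> = 1 / (2 * pi) * (LINT t|circ. h t * g t)"
    unfolding hg Bochner_Integration.integral_add[OF integrable_mult_right[OF i] integrable_mult_right[OF i]]
    by (simp add: fourier_coeff_def distrib_left mult.left_commute)
  finally have "\<bar>cmod (fourier_coeff g (int k)) + cmod (fourier_coeff g (- int k))\<bar>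
      = cmod (1 / (2 * pi) * (LINT t|circ. h t * g t))"
    by (metis norm_of_real real_norm_def)
  then have "cmod (fourier_coeff g (int k)) + cmod (fourier_coeff g (- int k))
      = 1 / (2 * pi) * cmod (LINT t|circ. h t * g t)"
    by (simp add: norm_mult norm_divide)
  also have "\<dots> \<le> 1 / (2 * pi) * (LINT t|circ. norm (h t * g t))"
    by (intro mult_left_mono integral_norm_bound) auto
  also have "\<dots> = 2 * (1 / (2 * pi) * (LINT t|circ. norm (g t) * norm (cos (real k * t + \<phi>))))"
  proof -
    have "norm (h t * g t) = 2 * (norm (g t) * norm (cos (real k * t + \<phi>)))" for t
    proof -
      have "(- a - real k * t - (- b + real k * t)) / 2 = - (real k * t + \<phi>)"
        by (simp add: \<phi>_def field_simps)
      then have "cmod (h t) = 2 * \<bar>cos (real k * t + \<phi>)\<bar>"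
        unfolding h_def norm_cis_add_cis by (simp only: cos_minus)
      then show ?thesis by (simp add: norm_mult)
    qed
    then show ?thesis by simp
  qed
  also have "\<dots> \<le> 2 * (Lp_norm p g * Lp_norm q (\<lambda>t. cos (real k * t + \<phi>)))"
  proof (rule mult_left_mono)
    have "in_Lp q (\<lambda>t. cos (real k * t + \<phi>))"
      by (rule in_Lp_continuous_le_one) (auto intro!: continuous_intros)
    from conjunct2[OF Hoelder[OF pq g this]]
    show "1 / (2 * pi) * (LINT t|circ. norm (g t) * norm (cos (real k * t + \<phi>)))
        \<le> Lp_norm p g * Lp_norm q (\<lambda>t. cos (real k * t + \<phi>))" .
  qed simp
  finally show ?thesis
    unfolding Lp_norm_cos_shift[OF k q] by (simp add: mult_ac)
qed

section \<open>Bounds for the coefficients of the expansion\<close>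

text \<open>A zero factor would make \<alpha> + 1 equal to -j for a natural number j, that is,
  \<alpha> a negative integer. This makes the divisions in the second estimate genuine.\<close>

lemma pochhammer_add_one_nonzero:
  assumes "\<alpha> \<notin> of_int ` {..<0}"
  shows "pochhammer (\<alpha> + 1 :: complex) k \<noteq> 0"
proof
  assume "pochhammer (\<alpha> + 1) k = 0"
  then obtain j where "\<alpha> + 1 = - of_nat j" unfolding pochhammer_eq_0_iff by blast
  then have "\<alpha> + 1 - 1 = - of_nat j - 1" by (rule arg_cong)
  then have "\<alpha> = of_int (- int j - 1)"
    unfolding add_diff_cancel_right' of_int_diff of_int_minus of_int_of_nat_eq of_int_1 .
  moreover have "- int j - 1 \<in> {..<0}" by simp
  ultimately show False using assms by (metis imageI)
qed

theorem theorem4: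
  fixes \<alpha> \<beta> :: complex and p q :: ennreal
    and f w :: "complex \<Rightarrow> complex" and c :: "int \<Rightarrow> complex"
  assumes "\<alpha> \<notin> of_int ` {..<0}" and "\<beta> \<notin> of_int ` {..<0}"
    and "Re (\<alpha> + \<beta>) > -1"
    and "1 \<le> p" and "1 / p + 1 / q = 1"
    and "in_Lp p (\<lambda>t. f (cis t))"
    and "\<And>z. z \<in> ball 0 1 \<Longrightarrow> w z = ab_Poisson \<alpha> \<beta> f z"
    and "root_limsup_le_1 c"
    and "\<And>z. z \<in> ball 0 1 \<Longrightarrow> w z = ab_expansion \<alpha> \<beta> c z"
  shows "\<forall>k::nat. k \<ge> 1 \<longrightarrow>
     (cmod (c (int k)) \<le>
        cmod (c_const \<alpha> \<beta>) * (cmod (pochhammer (\<alpha> + 1) k) / fact k) * Lp_norm p (\<lambda>t. f (cis t)) \<and>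
      cmod (c (- int k)) \<le>
        cmod (c_const \<alpha> \<beta>) * (cmod (pochhammer (\<beta> + 1) k) / fact k) * Lp_norm p (\<lambda>t. f (cis t))) \<and>
     (fact k / cmod (pochhammer (\<alpha> + 1) k) * cmod (c (int k)) +
      fact k / cmod (pochhammer (\<beta> + 1) k) * cmod (c (- int k))
        \<le> 2 * cmod (c_const \<alpha> \<beta>) * cos_const q k * Lp_norm p (\<lambda>t. f (cis t))) \<and>
     (q = \<infinity> \<longrightarrow> cos_const q k = 1) \<and>
     (p = \<infinity> \<longrightarrow> q = 1 \<and> cos_const q k = 2 / pi) \<and>
     (p = \<infinity> \<and> \<alpha> = 0 \<and> \<beta> = 0 \<longrightarrow>
        cmod (c (int k)) + cmod (c (- int k)) \<le> 4 / pi * Lp_norm \<infinity> (\<lambda>t. f (cis t)))"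
proof (intro allI impI)
  fix k :: nat assume k: "1 \<le> k"
  define g where "g t = f (cis t)" for t
  define C where "C = cmod (c_const \<alpha> \<beta>)"
  define A where "A = cmod (pochhammer (\<alpha> + 1) k)"
  define B where "B = cmod (pochhammer (\<beta> + 1) k)"
  have AB: "0 < A" "0 < B"
    using pochhammer_add_one_nonzero assms(1,2) by (auto simp: A_def B_def)
  note pq = assms(4,5)
  have g: "(\<lambda>t. f (cis t)) = g" by (simp add: g_def[abs_def])
  have Lp: "in_Lp p g" using assms(6) unfolding g .
  have int: "integrable circ (\<lambda>t. f (cis t))"
    using in_Lp_imp_integrable[OF pq assms(6)] .
  have eq: "\<And>z. z \<in> ball 0 1 \<Longrightarrow> ab_Poisson \<alpha> \<beta> f z = ab_expansion \<alpha> \<beta> c z"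
    using assms(7,9) by metis
  note coeffs = ab_expansion_coeffs[OF assms(3) int assms(8) eq k, unfolded g]
  have cp: "cmod (c (int k)) = C * (A / fact k) * cmod (fourier_coeff g (int k))"
    by (subst coeffs(1)) (simp_all add: C_def A_def norm_mult norm_divide)
  have cm: "cmod (c (- int k)) = C * (B / fact k) * cmod (fourier_coeff g (- int k))"
    by (subst coeffs(2)) (simp_all add: C_def B_def norm_mult norm_divide)
  have "0 \<le> C" by (simp add: C_def)
  have i: "cmod (c (int k)) \<le> C * (A / fact k) * Lp_norm p g"
    unfolding cp
    by (rule mult_left_mono[OF norm_fourier_coeff_le[OF pq Lp]]) (use AB \<open>0 \<le> C\<close> in auto)
  have i': "cmod (c (- int k)) \<le> C * (B / fact k) * Lp_norm p g"
    unfolding cm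
    by (rule mult_left_mono[OF norm_fourier_coeff_le[OF pq Lp]]) (use AB \<open>0 \<le> C\<close> in auto)
  \<comment> \<open>The weights cancel the factors A / k! and B / k! of the two coefficients,
    leaving the common constant C times the sum already bounded for Fourier coefficients.\<close>
  have "fact k / A * cmod (c (int k)) + fact k / B * cmod (c (- int k))
      = C * (cmod (fourier_coeff g (int k)) + cmod (fourier_coeff g (- int k)))"
    unfolding cp cm using AB by (simp add: field_simps)
  also have "\<dots> \<le> C * (2 * cos_const q k * Lp_norm p g)"
    by (intro mult_left_mono norm_fourier_coeff_pair_le pq Lp k) (simp add: C_def)
  finally have ii: "fact k / A * cmod (c (int k)) + fact k / B * cmod (c (- int k))
      \<le> 2 * C * cos_const q k * Lp_norm p g" by (simp add: mult_ac)
  have iii: "q = \<infinity> \<longrightarrow> cos_const q k = 1"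
    using Lp_norm_infinity_cos[OF k, of 0] by (simp add: cos_const_def)
  have iv: "q = 1 \<and> cos_const q k = 2 / pi" if "p = \<infinity>"
    using pq by (cases rule: conjugate_exponents_cases)
      (use that cos_const_one[OF k] in \<open>auto simp: infinity_ennreal_def\<close>)
  have v: "cmod (c (int k)) + cmod (c (- int k)) \<le> 4 / pi * Lp_norm \<infinity> g"
    if "p = \<infinity>" "\<alpha> = 0" "\<beta> = 0"
  proof -
    have "A = fact k" "B = fact k" "C = 1"
      using that by (auto simp: A_def B_def C_def c_const_def pochhammer_fact[symmetric])
    moreover have "q = 1" "cos_const q k = 2 / pi" using iv[OF that(1)] by auto
    ultimately show ?thesis using ii that(1) by (simp add: infinity_ennreal_def)
  qed
  have iv': "p = \<infinity> \<longrightarrow> q = 1 \<and> cos_const q k = 2 / pi" using iv by blast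
  have v': "p = \<infinity> \<and> \<alpha> = 0 \<and> \<beta> = 0 \<longrightarrow>
      cmod (c (int k)) + cmod (c (- int k)) \<le> 4 / pi * Lp_norm \<infinity> g" using v by blast
  show "(cmod (c (int k)) \<le>
        cmod (c_const \<alpha> \<beta>) * (cmod (pochhammer (\<alpha> + 1) k) / fact k) * Lp_norm p (\<lambda>t. f (cis t)) \<and>
      cmod (c (- int k)) \<le>
        cmod (c_const \<alpha> \<beta>) * (cmod (pochhammer (\<beta> + 1) k) / fact k) * Lp_norm p (\<lambda>t. f (cis t))) \<and>
     (fact k / cmod (pochhammer (\<alpha> + 1) k) * cmod (c (int k)) +
      fact k / cmod (pochhammer (\<beta> + 1) k) * cmod (c (- int k))
        \<le> 2 * cmod (c_const \<alpha> \<beta>) * cos_const q k * Lp_norm p (\<lambda>t. f (cis t))) \<and>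
     (q = \<infinity> \<longrightarrow> cos_const q k = 1) \<and>
     (p = \<infinity> \<longrightarrow> q = 1 \<and> cos_const q k = 2 / pi) \<and>
     (p = \<infinity> \<and> \<alpha> = 0 \<and> \<beta> = 0 \<longrightarrow>
        cmod (c (int k)) + cmod (c (- int k)) \<le> 4 / pi * Lp_norm \<infinity> (\<lambda>t. f (cis t)))"
    unfolding g A_def[symmetric] B_def[symmetric] C_def[symmetric]
    using i i' ii iii iv' v' by (intro conjI)
qed

end
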